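(* Let $n=2$, $s,\sigma\in(0,1)$, and let $(u,E)$ be a minimizing pair in any domain (i.e. in every bounded Lipschitz domain $\Omega\subset\mathbb R^2$). Assume that $u$ is continuous and homogeneous of degree $s-\frac\sigma2$ and that $E$ is the union of finitely many closed conical sectors (with vertex at the origin), with both $E$ and $E^c$ nonempty. Then $E$ is a halfplane.
   Context: $A^c=\mathbb R^n\setminus A$. For disjoint measurable $A,B\subseteq\mathbb R^n$ let $\mathcal L(A,B)=\iint_{A\times B}\frac{dx\,dy}{|x-y|^{n+\sigma}}$. For a bounded Lipschitz domain $\Omega\subset\mathbb R^n$ and measurable $E\subseteq\mathbb R^n$, $$\mathrm{Per}_\sigma(E,\Omega)=\mathcal L(E\cap\Omega,E^c\cap\Omega)+\mathcal L(E\cap\Omega,E^c\cap\Omega^c)+\mathcal L(E\cap\Omega^c,E^c\cap\Omega),$$ $$\mathcal F(u,E)=\iint_{\mathbb R^{2n}\setminus(\Omega^c)^2}\frac{|u(x)-u(y)|^2}{|x-y|^{n+2s}}\,dx\,dy+\mathrm{Per}_\sigma(E,\Omega).$$ Minimizing pair in $\Omega$: fix external data, i.e. a set $E_0\subseteq\mathbb R^n$ with locally finite $\sigma$-perimeter and $\varphi\in H^s_{\rm loc}(\mathbb R^n)$ with $\varphi\ge0$ a.e. in $E_0$ and $\varphi\le0$ a.e. in $E_0^c$; it is assumed that at least one admissible pair has finite energy. A pair $(v,F)$ is admissible if $v-\varphi\in H^s(\mathbb R^n)$, $v=\varphi$ a.e. in $\Omega^c$, $F\subseteq\mathbb R^n$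 is measurable with $F\setminus\Omega=E_0\setminus\Omega$, and $v\ge0$ a.e. in $F\cap\Omega$, $v\le0$ a.e. in $F^c\cap\Omega$. A pair $(u,E)$ is a minimizing pair in $\Omega$ if, for some such data, it is admissible and $\mathcal F(u,E)\le\mathcal F(v,F)$ for every admissible $(v,F)$. *)

theory Defs
  imports "HOL-Analysis.Analysis"
begin

text \<open>Double integrals over subsets of \<open>R\<^sup>n \<times> R\<^sup>n\<close> are integrals with respect to the
  (completed) Lebesgue measure on the product type, with values in \<open>[0,\<infinity>]\<close>. On the diagonal the
  kernels evaluate to \<open>0\<close> because of division by zero; the diagonal is a null set.\<close>

definition interaction :: "real \<Rightarrow> 'a::euclidean_space set \<Rightarrow> 'a set \<Rightarrow> ennreal" where
  "interaction \<sigma> A B =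
    (\<integral>\<^sup>+(x, y)\<in>A \<times> B. ennreal (1 / norm (x - y) powr (real DIM('a) + \<sigma>)) \<partial>lebesgue)"

definition frac_perimeter :: "real \<Rightarrow> 'a::euclidean_space set \<Rightarrow> 'a set \<Rightarrow> ennreal" where
  "frac_perimeter \<sigma> E \<Omega> =
     interaction \<sigma> (E \<inter> \<Omega>) (- E \<inter> \<Omega>)
   + interaction \<sigma> (E \<inter> \<Omega>) (- E \<inter> - \<Omega>)
   + interaction \<sigma> (E \<inter> - \<Omega>) (- E \<inter> \<Omega>)"

definition gagliardo :: "real \<Rightarrow> ('a::euclidean_space \<Rightarrow> real) \<Rightarrow> ('a \<times> 'a) set \<Rightarrow> ennreal" where
  "gagliardo s u Q =
    (\<integral>\<^sup>+(x, y)\<in>Q. ennreal (\<bar>u x - u y\<bar>\<^sup>2 / norm (x - y) powr (real DIM('a) + 2 * s)) \<partial>lebesgue)"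

definition energy ::
    "real \<Rightarrow> real \<Rightarrow> 'a::euclidean_space set \<Rightarrow> ('a \<Rightarrow> real) \<Rightarrow> 'a set \<Rightarrow> ennreal" where
  "energy s \<sigma> \<Omega> u E = gagliardo s u (UNIV - (- \<Omega>) \<times> (- \<Omega>)) + frac_perimeter \<sigma> E \<Omega>"

text \<open>Open connected sets whose boundary is locally the graph of a Lipschitz function over a
  hyperplane \<open>e\<^sup>\<bottom>\<close>, the domain lying locally above the graph; \<open>x - (x \<bullet> e) *\<^sub>R e\<close> is the orthogonal
  projection of \<open>x\<close> to that hyperplane.\<close>

definition bounded_lipschitz_domain :: "'a::euclidean_space set \<Rightarrow> bool" where
  "bounded_lipschitz_domain \<Omega> \<longleftrightarrow>
     \<Omega> \<noteq> {} \<and> open \<Omega> \<and> connected \<Omega> \<and> bounded \<Omega> \<and>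
     (\<forall>p \<in> frontier \<Omega>. \<exists>r e L g. r > 0 \<and> norm e = 1 \<and> L-lipschitz_on {y. y \<bullet> e = 0} g \<and>
        (\<forall>x \<in> ball p r. x \<in> \<Omega> \<longleftrightarrow> g (x - (x \<bullet> e) *\<^sub>R e) < x \<bullet> e))"

text \<open>The fractional Sobolev space \<open>H\<^sup>s(U)\<close> for open \<open>U\<close>.\<close>

definition in_Hs :: "real \<Rightarrow> 'a::euclidean_space set \<Rightarrow> ('a \<Rightarrow> real) \<Rightarrow> bool" where
  "in_Hs s U u \<longleftrightarrow> u \<in> borel_measurable (lebesgue_on U) \<and>
     (\<integral>\<^sup>+x\<in>U. ennreal ((u x)\<^sup>2) \<partial>lebesgue) < \<infinity> \<and> gagliardo s u (U \<times> U) < \<infinity>"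

definition in_Hs_loc :: "real \<Rightarrow> ('a::euclidean_space \<Rightarrow> real) \<Rightarrow> bool" where
  "in_Hs_loc s u \<longleftrightarrow> (\<forall>U. open U \<and> bounded U \<longrightarrow> in_Hs s U u)"

definition locally_finite_perimeter :: "real \<Rightarrow> 'a::euclidean_space set \<Rightarrow> bool" where
  "locally_finite_perimeter \<sigma> E \<longleftrightarrow> E \<in> sets lebesgue \<and>
     (\<forall>\<Omega>. bounded_lipschitz_domain \<Omega> \<longrightarrow> frac_perimeter \<sigma> E \<Omega> < \<infinity>)"

definition admissible ::
    "real \<Rightarrow> 'a::euclidean_space set \<Rightarrow> ('a \<Rightarrow> real) \<Rightarrow> 'a set \<Rightarrow> ('a \<Rightarrow> real) \<Rightarrow> 'a set \<Rightarrow> bool" where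
  "admissible s \<Omega> \<phi> E\<^sub>0 v F \<longleftrightarrow>
     in_Hs s UNIV (\<lambda>x. v x - \<phi> x) \<and>
     (AE x in lebesgue. x \<in> - \<Omega> \<longrightarrow> v x = \<phi> x) \<and>
     F \<in> sets lebesgue \<and> F - \<Omega> = E\<^sub>0 - \<Omega> \<and>
     (AE x in lebesgue. x \<in> F \<inter> \<Omega> \<longrightarrow> v x \<ge> 0) \<and>
     (AE x in lebesgue. x \<in> - F \<inter> \<Omega> \<longrightarrow> v x \<le> 0)"

definition external_data ::
    "real \<Rightarrow> real \<Rightarrow> 'a::euclidean_space set \<Rightarrow> ('a \<Rightarrow> real) \<Rightarrow> 'a set \<Rightarrow> bool" where
  "external_data s \<sigma> \<Omega> \<phi> E\<^sub>0 \<longleftrightarrow>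
     locally_finite_perimeter \<sigma> E\<^sub>0 \<and> in_Hs_loc s \<phi> \<and>
     (AE x in lebesgue. x \<in> E\<^sub>0 \<longrightarrow> \<phi> x \<ge> 0) \<and>
     (AE x in lebesgue. x \<in> - E\<^sub>0 \<longrightarrow> \<phi> x \<le> 0) \<and>
     (\<exists>v F. admissible s \<Omega> \<phi> E\<^sub>0 v F \<and> energy s \<sigma> \<Omega> v F < \<infinity>)"

definition minimizing_pair ::
    "real \<Rightarrow> real \<Rightarrow> 'a::euclidean_space set \<Rightarrow> ('a \<Rightarrow> real) \<Rightarrow> 'a set \<Rightarrow> bool" where
  "minimizing_pair s \<sigma> \<Omega> u E \<longleftrightarrow>
     (\<exists>\<phi> E\<^sub>0. external_data s \<sigma> \<Omega> \<phi> E\<^sub>0 \<and> admissible s \<Omega> \<phi> E\<^sub>0 u E \<and>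
        (\<forall>v F. admissible s \<Omega> \<phi> E\<^sub>0 v F \<longrightarrow> energy s \<sigma> \<Omega> u E \<le> energy s \<sigma> \<Omega> v F))"

definition homogeneous :: "real \<Rightarrow> ('a::real_vector \<Rightarrow> real) \<Rightarrow> bool" where
  "homogeneous d u \<longleftrightarrow> (\<forall>t>0. \<forall>x. u (t *\<^sub>R x) = t powr d * u x)"

text \<open>Sectors have positive opening: a single ray is not a sector.\<close>

definition closed_sector :: "(real^2) set \<Rightarrow> bool" where
  "closed_sector S \<longleftrightarrow> (\<exists>a b. a < b \<and> b < a + 2 * pi \<and>
     S = {vector [r * cos t, r * sin t] | r t. 0 \<le> r \<and> t \<in> {a..b}})"

definition halfplane :: "(real^2) set \<Rightarrow> bool" where
  "halfplane H \<longleftrightarrow> (\<exists>a b. a \<noteq> 0 \<and> H = {x. a \<bullet> x \<ge> b})"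

end

theory Submission
  imports Defs
begin

text \<open>
  Push \<open>(u, E)\<close> inside the unit ball by \<open>T\<^sub>t x = x + t \<phi>(x) e\<close>, where \<open>\<phi>\<close> is a bump with \<open>\<phi>(0) = 1\<close>.
  After the change of variables \<open>T\<^sub>t\<close> only the kernel depends on \<open>t\<close>, and
  its second difference in \<open>t\<close> is at most \<open>C t\<^sup>2\<close> times the kernel. Since the push by \<open>-t\<close> also gives a
  competitor, minimality yields that the energy of the pushed pair \<open>(u\<^sub>t, E\<^sub>t)\<close> exceeds that of \<open>(u, E)\<close> by at
  most \<open>C t\<^sup>2\<close>. The energy is submodular: replacing \<open>(u, E)\<close> and \<open>(u\<^sub>t, E\<^sub>t)\<close> by their
  maximum/union and minimum/intersection, again competitors, lowers the total by at least the
  interaction of \<open>E - E\<^sub>t\<close> and \<open>E\<^sub>t - E\<close>, which is therefore at most \<open>C t\<^sup>2\<close>.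

  If the cone \<open>E\<close> were mapped into itself neither by the translation by \<open>e\<close> nor by that by \<open>-e\<close>, then both
  sets would contain balls of radius \<open>\<epsilon>t\<close> at distance of order \<open>t\<close>, whose interaction is of order
  \<open>t\<^bsup>2-\<sigma>\<^esup>\<close>; this is impossible for small \<open>t\<close>. Hence \<open>E + e \<subseteq> E\<close> or \<open>E - e \<subseteq> E\<close> for every \<open>e\<close>, so the
  closed convex cone of all \<open>e\<close> with \<open>E + e \<subseteq> E\<close> together with its negative covers the plane, and
  it is a halfplane equal to \<open>E\<close>.\<close>

subsection \<open>Second variation of the kernel\<close>

text \<open>For negative \<open>z\<close> the Taylor bound
  \<open>1 + y + y\<^sup>2 / 2 \<le> exp y\<close> at \<open>y = - z\<close> is inverted: its left
  side times \<open>1 - y + y\<^sup>2\<close> is at least 1.\<close>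

lemma exp_le_quadratic:
  fixes z :: real
  assumes "z \<le> 1"
  shows "exp z \<le> 1 + z + z\<^sup>2"
proof (cases "z \<ge> 0")
  case True
  then show ?thesis using exp_bound assms by auto
next
  case False
  define y where "y = - z"
  have y: "y > 0" using False by (simp add: y_def)
  have "1 + y + y\<^sup>2 / 2 \<le> exp y" using exp_lower_Taylor_quadratic y by auto
  moreover have "(1 + y + y\<^sup>2 / 2) * (1 - y + y\<^sup>2) = 1 + y\<^sup>2 / 2 + y^3 / 2 + y^4 / 2"
    by (simp add: field_simps power2_eq_square power3_eq_cube power4_eq_xxxx)
  moreover have "1 \<le> 1 + y\<^sup>2 / 2 + y^3 / 2 + y^4 / 2" using y by simp
  moreover have "1 - y + y\<^sup>2 > 0"
  proof -
    have "1 - y + y\<^sup>2 = (y - 1/2)\<^sup>2 + 3/4" by (simp add: power2_eq_square field_simps)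
    then show ?thesis by (metis add_nonneg_pos zero_le_power2 zero_less_divide_iff zero_less_numeral)
  qed
  ultimately have "1 \<le> exp y * (1 - y + y\<^sup>2)"
    using mult_right_mono[of "1 + y + y\<^sup>2 / 2" "exp y" "1 - y + y\<^sup>2"] by linarith
  then have "exp (- y) \<le> 1 - y + y\<^sup>2"
    by (simp add: exp_minus field_simps)
  then show ?thesis by (simp add: y_def)
qed

text \<open>The squared norm of \<open>d + t *\<^sub>R w\<close> is a quadratic polynomial in
  \<open>t\<close>, hence the exponent is written \<open>2 * r\<close>. The bound is an exponential
  so that it can be multiplied with similar bounds for the Jacobian factors; its first-order term in
  \<open>t\<close> is exact.\<close>

lemma kernel_ratio_le_exp:
  fixes d w :: "'a::real_inner"
  assumes d: "d \<noteq> 0" and w: "norm w \<le> M * norm d" and r: "0 \<le> r" "r \<le> 2"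
    and t: "\<bar>t\<bar> * M \<le> 1/16" and M: "M \<ge> 0"
  shows "1 / norm (d + t *\<^sub>R w) powr (2 * r)
    \<le> exp (- 2 * r * t * ((d \<bullet> w) / (norm d)\<^sup>2) + 36 * (t * M)\<^sup>2) / norm d powr (2 * r)"
proof -
  define \<alpha> where "\<alpha> = (d \<bullet> w) / (norm d)\<^sup>2"
  define \<beta> where "\<beta> = (norm w)\<^sup>2 / (norm d)\<^sup>2"
  define q where "q = 2 * t * \<alpha> + t\<^sup>2 * \<beta>"
  have nd: "norm d > 0" using d by simp
  have "\<bar>d \<bullet> w\<bar> \<le> norm d * (M * norm d)"
    using Cauchy_Schwarz_ineq2[of d w] mult_left_mono[OF w, of "norm d"] by simp
  then have a: "\<bar>\<alpha>\<bar> \<le> M"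
    using nd by (simp add: \<alpha>_def power2_eq_square field_simps)
  have "(norm w)\<^sup>2 \<le> (M * norm d)\<^sup>2" using w by (simp add: power_mono)
  then have b: "\<beta> \<le> M\<^sup>2" "\<beta> \<ge> 0"
    using nd by (simp_all add: \<beta>_def field_simps)
  have tb: "0 \<le> t\<^sup>2 * \<beta>" "t\<^sup>2 * \<beta> \<le> (t * M)\<^sup>2"
    using b by (auto simp: power_mult_distrib intro: mult_left_mono)
  have sm: "(t * M)\<^sup>2 \<le> \<bar>t\<bar> * M"
  proof -
    have "(t * M)\<^sup>2 = (\<bar>t\<bar> * M) * (\<bar>t\<bar> * M)" by (simp add: power2_eq_square mult_ac flip: abs_mult)
    also have "\<dots> \<le> (\<bar>t\<bar> * M) * 1" using t M by (intro mult_left_mono) auto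
    finally show ?thesis by simp
  qed
  have ta: "\<bar>t * \<alpha>\<bar> \<le> \<bar>t\<bar> * M" using a by (simp add: abs_mult mult_left_mono)
  have q: "\<bar>q\<bar> \<le> 3 * (\<bar>t\<bar> * M)"
    unfolding q_def using tb sm ta by linarith
  have q12: "\<bar>q\<bar> \<le> 1/2" using q t by linarith
  have "q\<^sup>2 \<le> (3 * (\<bar>t\<bar> * M))\<^sup>2" using q by (metis abs_ge_zero power2_abs power_mono)
  then have q2: "q\<^sup>2 \<le> 9 * (t * M)\<^sup>2" by (simp add: power_mult_distrib)
  have "(norm (d + t *\<^sub>R w))\<^sup>2 = (norm d)\<^sup>2 + 2 * t * (d \<bullet> w) + t\<^sup>2 * (norm w)\<^sup>2"
    unfolding power2_norm_eq_inner by (simp add: algebra_simps inner_commute power2_eq_square)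
  also have "\<dots> = (norm d)\<^sup>2 * (1 + q)"
    using nd by (simp add: q_def \<alpha>_def \<beta>_def field_simps)
  finally have n2: "(norm (d + t *\<^sub>R w))\<^sup>2 = (norm d)\<^sup>2 * (1 + q)" .
  have sq: "x powr (2 * r) = (x\<^sup>2) powr r" if "x \<ge> 0" for x :: real
    using that powr_powr[of x 2 r] by (cases "x = 0") simp_all
  have l: "ln (1 + q) \<ge> q - 2 * q\<^sup>2"
    using abs_ln_one_plus_x_minus_x_bound[of q] q12 by linarith
  have "norm (d + t *\<^sub>R w) powr (2 * r) = norm d powr (2 * r) * (1 + q) powr r"
    using q12 by (simp add: sq n2 powr_mult)
  also have "(1 + q) powr r = exp (r * ln (1 + q))"
    using q12 by (simp add: powr_def)
  finally have "1 / norm (d + t *\<^sub>R w) powr (2 * r) = exp (- (r * ln (1 + q))) / norm d powr (2 * r)"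
    by (simp add: exp_minus field_simps)
  \<comment> \<open>The constant is 36 = 2 * 2 * 9, from \<open>r \<le> 2\<close>, the quadratic
    error of \<open>ln\<close> and the bound \<open>q2\<close>. The term
    \<open>r * (t\<^sup>2 * \<beta>)\<close> has a favourable sign and is dropped.\<close>
  also have "- (r * ln (1 + q)) \<le> - 2 * r * t * \<alpha> + 36 * (t * M)\<^sup>2"
  proof -
    have "r * (q - 2 * q\<^sup>2) \<le> r * ln (1 + q)" using l r by (intro mult_left_mono)
    moreover have "r * q\<^sup>2 \<le> 2 * q\<^sup>2" using r by (intro mult_right_mono) auto
    moreover have "r * q = 2 * r * t * \<alpha> + r * (t\<^sup>2 * \<beta>)" by (simp add: q_def algebra_simps)
    moreover have "r * (t\<^sup>2 * \<beta>) \<ge> 0" using tb r by simp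
    ultimately show ?thesis using q2 by (simp add: algebra_simps)
  qed
  finally show ?thesis
    using nd unfolding \<alpha>_def by (simp add: divide_right_mono)
qed

text \<open>The first-order terms in \<open>t\<close> cancel between \<open>t\<close> and \<open>-t\<close>.\<close>

lemma kernel_second_variation:
  fixes d w :: "'a::real_inner"
  assumes w: "norm w \<le> M * norm d" and r: "0 \<le> r" "r \<le> 2"
    and ab: "\<bar>a\<bar> \<le> M" "\<bar>b\<bar> \<le> M" and t: "\<bar>t\<bar> * M \<le> 1/16"
  shows "(1 + t * a) * (1 + t * b) / norm (d + t *\<^sub>R w) powr (2 * r)
       + (1 - t * a) * (1 - t * b) / norm (d - t *\<^sub>R w) powr (2 * r)
    \<le> (2 + 400 * (t * M)\<^sup>2) / norm d powr (2 * r)"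
proof (cases "d = 0")
  \<comment> \<open>Then \<open>w\<close> vanishes too, and both sides are 0 by division by
    zero.\<close>
  case True
  then show ?thesis using w by simp
next
  case False
  have M: "M \<ge> 0" using ab by linarith
  define \<alpha> where "\<alpha> = (d \<bullet> w) / (norm d)\<^sup>2"
  \<comment> \<open>The derivative at \<open>t = 0\<close> of the logarithm of the Jacobian factors
    times the kernel ratio.\<close>
  define m where "m = a + b - 2 * r * \<alpha>"
  have nd: "norm d > 0" using False by simp
  have "\<bar>d \<bullet> w\<bar> \<le> norm d * (M * norm d)"
    using Cauchy_Schwarz_ineq2[of d w] mult_left_mono[OF w, of "norm d"] by simp
  then have al: "\<bar>\<alpha>\<bar> \<le> M"
    using nd by (simp add: \<alpha>_def power2_eq_square field_simps)
  have "\<bar>r * \<alpha>\<bar> \<le> 2 * M" using al r by (simp add: abs_mult mult_mono)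
  then have m: "\<bar>m\<bar> \<le> 6 * M" using ab unfolding m_def by linarith
  have bnd: "(1 + h * a) * (1 + h * b) / norm (d + h *\<^sub>R w) powr (2 * r)
     \<le> (1 + (h * m + 36 * (t * M)\<^sup>2) + (h * m + 36 * (t * M)\<^sup>2)\<^sup>2) / norm d powr (2 * r)"
    (is "_ \<le> (1 + ?z + ?z\<^sup>2) / _") if h: "\<bar>h\<bar> = \<bar>t\<bar>" for h
  proof -
    have hM: "(h * M)\<^sup>2 = (t * M)\<^sup>2" using h by (metis abs_mult power2_abs)
    have ha: "\<bar>h * a\<bar> \<le> 1/16" "\<bar>h * b\<bar> \<le> 1/16"
      using mult_left_mono[OF ab(1), of "\<bar>t\<bar>"] mult_left_mono[OF ab(2), of "\<bar>t\<bar>"] t h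
      by (simp_all add: abs_mult)
    have "\<bar>h * m\<bar> \<le> \<bar>t\<bar> * (6 * M)" using m h by (simp add: abs_mult mult_left_mono)
    then have hm: "\<bar>h * m\<bar> \<le> 6/16" using t by linarith
    have "(t * M)\<^sup>2 \<le> (1/16)\<^sup>2"
      using t M by (metis abs_ge_zero abs_mult abs_of_nonneg power2_abs power_mono)
    then have tM: "(t * M)\<^sup>2 \<le> 1/256" by (simp add: power2_eq_square)
    have "(1 + h * a) * (1 + h * b) \<le> exp (h * a) * exp (h * b)"
      using ha by (intro mult_mono) auto
    also have "\<dots> = exp (h * a + h * b)" by (simp add: exp_add)
    finally have J: "(1 + h * a) * (1 + h * b) \<le> exp (h * a + h * b)" .
    have "1 / norm (d + h *\<^sub>R w) powr (2 * r)
      \<le> exp (- 2 * r * h * \<alpha> + 36 * (t * M)\<^sup>2) / norm d powr (2 * r)"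
      using kernel_ratio_le_exp[OF False w r, of h] t h M unfolding \<alpha>_def hM by simp
    then have "(1 + h * a) * (1 + h * b) * (1 / norm (d + h *\<^sub>R w) powr (2 * r))
      \<le> exp (h * a + h * b) * (exp (- 2 * r * h * \<alpha> + 36 * (t * M)\<^sup>2) / norm d powr (2 * r))"
      using J ha by (intro mult_mono) auto
    also have "\<dots> = exp ?z / norm d powr (2 * r)"
      by (simp add: exp_add[symmetric] m_def algebra_simps)
    also have "\<dots> \<le> (1 + ?z + ?z\<^sup>2) / norm d powr (2 * r)"
      using exp_le_quadratic[of ?z] hm tM by (intro divide_right_mono) auto
    finally show ?thesis by simp
  qed
  have "(t * M)\<^sup>2 \<le> (1/16)\<^sup>2"
    using t M by (metis abs_ge_zero abs_mult abs_of_nonneg power2_abs power_mono)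
  then have tM: "(t * M)\<^sup>2 \<le> 1/256" by (simp add: power2_eq_square)
  have "(t * m)\<^sup>2 \<le> (\<bar>t\<bar> * (6 * M))\<^sup>2"
    using power_mono[OF mult_left_mono[OF m, of "\<bar>t\<bar>"], of 2] by (simp add: power_mult_distrib)
  then have tm: "(t * m)\<^sup>2 \<le> 36 * (t * M)\<^sup>2" by (simp add: power_mult_distrib)
  have t4: "((t * M)\<^sup>2)\<^sup>2 \<le> (t * M)\<^sup>2 / 256"
    using mult_left_mono[OF tM, of "(t * M)\<^sup>2"] by (simp add: power2_eq_square)
  define X where "X = (t * M)\<^sup>2"
  have X: "X\<^sup>2 \<le> X / 256" "(t * m)\<^sup>2 \<le> 36 * X" "X \<ge> 0" using t4 tm by (simp_all add: X_def)
  have "(1 + (t * m + 36 * X) + (t * m + 36 * X)\<^sup>2) + (1 + (- t * m + 36 * X) + (- t * m + 36 * X)\<^sup>2)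
    = 2 + 72 * X + 2 * (t * m)\<^sup>2 + 2592 * X\<^sup>2"
    by (simp add: power2_eq_square algebra_simps)
  \<comment> \<open>The square of \<open>t * m\<close> contributes at most 72 \<open>X\<close>, and
    \<open>2592 * X\<^sup>2\<close> less than 11 \<open>X\<close> because
    \<open>X \<le> 1/256\<close>; the constant 400 is generous.\<close>
  also have "\<dots> \<le> 2 + 400 * X" using X by linarith
  finally have "((1 + (t * m + 36 * X) + (t * m + 36 * X)\<^sup>2) + (1 + (- t * m + 36 * X) + (- t * m + 36 * X)\<^sup>2))
     / norm d powr (2 * r) \<le> (2 + 400 * X) / norm d powr (2 * r)"
    by (intro divide_right_mono) auto
  then show ?thesis
    using bnd[of t] bnd[of "-t"] unfolding X_def[symmetric]
    by (simp add: add_divide_distrib diff_divide_distrib)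
qed

section \<open>Change of variables for nonnegative integrals\<close>

text \<open>The image under \<open>g\<close> of the measure with density the Jacobian agrees with
  Lebesgue measure on boxes, by the formula for the measure of a differentiable image. Boxes
  determine the measure, so the identity holds for all Borel integrands at once, including those
  with infinite integral.\<close>

lemma nn_integral_change_of_variables:
  fixes g :: "real^'n::{finite,wellorder} \<Rightarrow> real^'n::_"
  assumes der: "\<And>x. (g has_derivative g' x) (at x)" and bij: "bij g"
    and J: "continuous_on UNIV (\<lambda>x. det (matrix (g' x)))"
    and f: "f \<in> borel_measurable borel"
  shows "(\<integral>\<^sup>+x. f x \<partial>lborel) = (\<integral>\<^sup>+x. ennreal \<bar>det (matrix (g' x))\<bar> * f (g x) \<partial>lborel)"
proof -
  let ?D = "\<lambda>x. \<bar>det (matrix (g' x))\<bar>"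
  have "continuous_on UNIV g"
    using der by (meson UNIV_I continuous_at_imp_continuous_on has_derivative_continuous)
  then have g[measurable]: "g \<in> borel_measurable borel" by (rule borel_measurable_continuous_onI)
  have D[measurable]: "?D \<in> borel_measurable borel"
    using J by (intro borel_measurable_continuous_onI continuous_intros)
  have "lborel = distr (density lborel ?D) borel g"
  proof (rule lborel_eqI)
    fix l u :: "real^'n::_"
    let ?S = "g -` box l u"
    assume "\<And>b. b \<in> Basis \<Longrightarrow> l \<bullet> b \<le> u \<bullet> b"
    then have box: "emeasure lborel (box l u) = ennreal (\<Prod>b\<in>Basis. (u - l) \<bullet> b)"
      by (simp add: emeasure_lborel_box_eq)
    have S[measurable]: "?S \<in> sets borel" using measurable_sets[OF g, of "box l u"] by simp
    have img: "g ` ?S = box l u" using bij by (simp add: bij_is_surj surj_image_vimage_eq)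
    have "(g has_derivative g' x) (at x within ?S)" for x
      using der has_derivative_at_withinI by blast
    moreover have "inj_on g ?S" using bij by (meson bij_is_inj inj_on_subset subset_UNIV)
    moreover have "?S \<in> sets lebesgue" using S by auto
    ultimately have "(?D has_integral measure lebesgue (box l u)) ?S"
      using has_measure_differentiable_image[of ?S g g' "measure lebesgue (box l u)"]
      unfolding img by simp
    then have "(\<integral>\<^sup>+x. ennreal (?D x) * indicator ?S x \<partial>lborel) = ennreal (measure lebesgue (box l u))"
      by (intro nn_integral_has_integral_lebesgue') auto
    moreover have "ennreal (measure lebesgue (box l u)) = emeasure lborel (box l u)"
      using emeasure_lborel_box_finite[of l u] by (simp add: emeasure_eq_ennreal_measure)
    ultimately have "(\<integral>\<^sup>+x. ennreal (?D x) * indicator ?S x \<partial>lborel) = (\<Prod>b\<in>Basis. (u - l) \<bullet> b)"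
      using box by (simp only:)
    moreover have "emeasure (distr (density lborel ?D) borel g) (box l u)
        = (\<integral>\<^sup>+x. ennreal (?D x) * indicator ?S x \<partial>lborel)"
      by (simp add: emeasure_distr emeasure_density)
    ultimately show "emeasure (distr (density lborel ?D) borel g) (box l u) = (\<Prod>b\<in>Basis. (u - l) \<bullet> b)"
      by (simp only:)
  qed simp
  then have "(\<integral>\<^sup>+x. f x \<partial>lborel) = (\<integral>\<^sup>+x. f x \<partial>distr (density lborel ?D) borel g)"
    by simp
  also have "\<dots> = (\<integral>\<^sup>+x. ?D x * f (g x) \<partial>lborel)"
    using f by (simp add: nn_integral_distr nn_integral_density)
  finally show ?thesis .
qed

subsection \<open>The push\<close>

text \<open>The square makes the truncated paraboloid continuously differentiable across the unit
  sphere while keeping its derivative explicit.\<close>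

definition bump :: "'a::real_inner \<Rightarrow> real" where
  "bump x = (max 0 (1 - x \<bullet> x))\<^sup>2"

lemma bump_bounds: "0 \<le> bump x" "bump x \<le> 1"
  by (simp_all add: bump_def power_le_one)

lemma bump_eq_0: "norm x \<ge> 1 \<Longrightarrow> bump x = 0"
  using one_le_power[of "norm x" 2] by (simp add: bump_def dot_square_norm)

text \<open>Near the origin the push therefore differs from the translation by
  \<open>t *\<^sub>R e\<close> only by an error quadratic in the distance.\<close>

lemma one_minus_bump_le: "1 - bump x \<le> 2 * (norm x)\<^sup>2"
proof -
  have "(max 0 (1 - x \<bullet> x))\<^sup>2 \<ge> 1 - 2 * (x \<bullet> x)"
  proof (cases "x \<bullet> x \<le> 1")
    case True
    then show ?thesis by (simp add: power2_eq_square algebra_simps)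
  next
    case False
    then show ?thesis by (smt (verit) zero_le_power2)
  qed
  then show ?thesis by (simp add: bump_def dot_square_norm)
qed

text \<open>Truncating the norm at 1 instead of the paraboloid at 0 turns the increments into two
  successive differences of squares, each of which costs a factor 2.\<close>

lemma bump_lipschitz: "\<bar>bump x - bump y\<bar> \<le> 4 * norm (x - y)"
proof -
  let ?m = "\<lambda>x::'a. max 0 (1 - x \<bullet> x)"
  let ?n = "\<lambda>x::'a. min 1 (norm x)"
  have m: "?m x = 1 - (?n x)\<^sup>2" for x
  proof (cases "norm x \<le> 1")
    case True
    then show ?thesis by (simp add: dot_square_norm power_le_one)
  next
    case False
    then show ?thesis using one_le_power[of "norm x" 2] by (simp add: dot_square_norm)
  qed
  have n: "\<bar>?n x - ?n y\<bar> \<le> norm (x - y)"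
    using norm_triangle_ineq3[of x y] by linarith
  have "?m x - ?m y = (?n y + ?n x) * (?n y - ?n x)"
    unfolding m by (simp add: power2_eq_square algebra_simps)
  then have "\<bar>?m x - ?m y\<bar> = (?n y + ?n x) * \<bar>?n x - ?n y\<bar>"
    by (simp add: abs_mult abs_minus_commute)
  also have "\<dots> \<le> 2 * norm (x - y)"
    using n by (intro mult_mono) auto
  finally have md: "\<bar>?m x - ?m y\<bar> \<le> 2 * norm (x - y)" .
  have "bump x - bump y = (?m x + ?m y) * (?m x - ?m y)"
    unfolding bump_def by (simp add: power2_eq_square algebra_simps)
  then have "\<bar>bump x - bump y\<bar> = (?m x + ?m y) * \<bar>?m x - ?m y\<bar>"
    by (simp add: abs_mult)
  also have "\<dots> \<le> 2 * (2 * norm (x - y))"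
  proof (rule mult_mono)
    have "?m z \<le> 1" for z :: 'a by simp
    from this[of x] this[of y] show "?m x + ?m y \<le> 2" by linarith
  qed (use md in auto)
  finally show ?thesis by simp
qed

lemma has_real_derivative_max_0_square:
  "((\<lambda>t::real. (max 0 t)\<^sup>2) has_real_derivative 2 * max 0 t) (at t)"
proof -
  consider "t < 0" | "t = 0" | "t > 0" by linarith
  then show ?thesis
  proof cases
    case 1
    have "((\<lambda>t::real. 0) has_real_derivative 2 * max 0 t) (at t)" using 1 by simp
    then show ?thesis
      by (rule has_field_derivative_transform_within_open[of _ _ _ "{..<0}"]) (use 1 in auto)
  next
    case 2
    have "\<bar>(max 0 h)\<^sup>2 / h\<bar> \<le> \<bar>h\<bar>" for h :: real
      by (cases "h > 0") (auto simp: power2_eq_square)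
    then have "\<forall>\<^sub>F h in at 0. norm ((max 0 h)\<^sup>2 / h) \<le> \<bar>h\<bar>"
      unfolding real_norm_def by (rule always_eventually[OF allI])
    moreover have "((\<lambda>h::real. \<bar>h\<bar>) \<longlongrightarrow> 0) (at 0)"
      by (rule tendsto_rabs_zero[OF tendsto_ident_at])
    ultimately have "((\<lambda>h::real. (max 0 h)\<^sup>2 / h) \<longlongrightarrow> 0) (at 0)"
      by (rule Lim_null_comparison)
    then show ?thesis using 2 by (simp add: DERIV_def)
  next
    case 3
    have "((\<lambda>t::real. t\<^sup>2) has_real_derivative 2 * max 0 t) (at t)"
      using 3 by (auto intro!: derivative_eq_intros)
    then show ?thesis
      by (rule has_field_derivative_transform_within_open[of _ _ _ "{0<..}"]) (use 3 in auto)
  qed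
qed

lemma bump_has_derivative:
  "(bump has_derivative (\<lambda>h. - 4 * max 0 (1 - x \<bullet> x) * (x \<bullet> h))) (at x)"
proof -
  have "((\<lambda>x. 1 - x \<bullet> x) has_derivative (\<lambda>h. - 2 * (x \<bullet> h))) (at x)"
    by (auto intro!: derivative_eq_intros simp: inner_commute)
  from has_derivative_compose[OF this has_real_derivative_max_0_square[THEN has_field_derivative_imp_has_derivative]]
  show ?thesis by (simp add: bump_def[abs_def] mult_ac)
qed

definition push :: "real \<Rightarrow> 'a::real_inner \<Rightarrow> 'a \<Rightarrow> 'a" where
  "push t e x = x + (t * bump x) *\<^sub>R e"

text \<open>The Jacobian determinant of \<open>push t e\<close>, namely one plus \<open>t\<close>
  times the derivative of \<open>bump\<close> in direction \<open>e\<close>.\<close>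

definition push_jac :: "real \<Rightarrow> 'a::real_inner \<Rightarrow> 'a \<Rightarrow> real" where
  "push_jac t e x = 1 + t * (- 4 * max 0 (1 - x \<bullet> x) * (x \<bullet> e))"

lemma bump_slope_le: "\<bar>- 4 * max 0 (1 - x \<bullet> x) * (x \<bullet> e)\<bar> \<le> 4 * norm e"
proof (cases "norm x \<le> 1")
  case True
  have "\<bar>x \<bullet> e\<bar> \<le> 1 * norm e"
    using Cauchy_Schwarz_ineq2[of x e] mult_right_mono[OF True, of "norm e"] by simp
  moreover have "0 \<le> max 0 (1 - x \<bullet> x)" "max 0 (1 - x \<bullet> x) \<le> 1" by auto
  ultimately have "max 0 (1 - x \<bullet> x) * \<bar>x \<bullet> e\<bar> \<le> 1 * (1 * norm e)" by (intro mult_mono) auto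
  then show ?thesis by (simp add: abs_mult)
next
  case False
  then have "x \<bullet> x \<ge> 1" using one_le_power[of "norm x" 2] by (simp add: dot_square_norm)
  then show ?thesis by simp
qed

lemma push_diff: "push t e x - push t e y = (x - y) + t *\<^sub>R ((bump x - bump y) *\<^sub>R e)"
  by (simp add: push_def algebra_simps)

lemma bump_diff_norm: "norm ((bump x - bump y) *\<^sub>R e) \<le> 4 * norm e * norm (x - y)"
  using mult_right_mono[OF bump_lipschitz[of x y], of "norm e"] by (simp add: mult_ac)

text \<open>Since \<open>4 * norm e\<close> is a Lipschitz constant of
  \<open>bump x *\<^sub>R e\<close>, the displacement is Lipschitz with constant at most 1/16. The
  estimate yields injectivity of the push and a Lipschitz inverse.\<close>

lemma push_expansive:
  assumes "\<bar>t\<bar> * (4 * norm e) \<le> 1/16"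
  shows "norm (x - y) \<le> 2 * norm (push t e x - push t e y)"
proof -
  have "norm (t *\<^sub>R ((bump x - bump y) *\<^sub>R e)) \<le> \<bar>t\<bar> * (4 * norm e * norm (x - y))"
    using mult_left_mono[OF bump_diff_norm[of x y e], of "\<bar>t\<bar>"] by (simp add: abs_mult mult_ac)
  also have "\<dots> \<le> 1/16 * norm (x - y)"
    using mult_right_mono[OF assms, of "norm (x - y)"] by (simp add: mult_ac)
  finally show ?thesis
    unfolding push_diff using norm_diff_ineq[of "x - y" "t *\<^sub>R ((bump x - bump y) *\<^sub>R e)"]
      norm_ge_zero[of "x - y"]
    by linarith
qed

lemma push_bij:
  fixes e :: "'a::euclidean_space"
  assumes t: "\<bar>t\<bar> * (4 * norm e) \<le> 1/16"
  shows "bij (push t e)"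
proof (rule bijI)
  show "inj (push t e)"
  proof (rule injI)
    fix x y assume "push t e x = push t e y"
    then show "x = y" using push_expansive[OF t, of x y] by simp
  qed
  show "surj (push t e)"
  proof (rule surjI)
    fix z
    \<comment> \<open>The preimages of \<open>z\<close> are the fixed points of this
      contraction.\<close>
    let ?f = "\<lambda>x. z - (t * bump x) *\<^sub>R e"
    have "dist (?f x) (?f y) \<le> 1/16 * dist x y" for x y
    proof -
      have "?f x - ?f y = t *\<^sub>R ((bump y - bump x) *\<^sub>R e)" by (simp add: algebra_simps)
      then have "norm (?f x - ?f y) \<le> \<bar>t\<bar> * (4 * norm e * norm (y - x))"
        using mult_left_mono[OF bump_diff_norm[of y x e], of "\<bar>t\<bar>"] by (simp add: abs_mult mult_ac)
      also have "\<dots> \<le> 1/16 * norm (y - x)"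
        using mult_right_mono[OF t, of "norm (y - x)"] by (simp add: mult_ac)
      finally show ?thesis by (simp add: dist_norm norm_minus_commute)
    qed
    then have "\<exists>!x. ?f x = x" by (intro banach_fix_type[of "1/16"]) auto
    then have "?f (SOME x. ?f x = x) = (SOME x. ?f x = x)" by (metis (mono_tags, lifting) someI)
    then show "push t e (SOME x. ?f x = x) = z" by (simp add: push_def algebra_simps)
  qed
qed

lemma push_outside: "norm x \<ge> 1 \<Longrightarrow> push t e x = x"
  by (simp add: push_def bump_eq_0)

text \<open>Points outside the ball are fixed, so by injectivity no inner point can land among them.
  This makes the integration domain of the energy invariant under the push in both
  variables.\<close>

lemma push_mem_ball:
  fixes e :: "'a::euclidean_space"
  assumes t: "\<bar>t\<bar> * (4 * norm e) \<le> 1/16"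
  shows "push t e x \<in> ball 0 1 \<longleftrightarrow> x \<in> ball 0 1"
proof -
  have "inj (push t e)" using push_bij[OF t] bij_is_inj by blast
  then show ?thesis
    using push_outside[of x t e] push_outside[of "push t e x" t e]
    by (metis dist_0_norm injD linorder_not_le mem_ball)
qed

lemma push_has_derivative:
  "(push t e has_derivative (\<lambda>h. h + (t * (- 4 * max 0 (1 - x \<bullet> x) * (x \<bullet> h))) *\<^sub>R e)) (at x)"
  unfolding push_def[abs_def]
  by (auto intro!: derivative_eq_intros bump_has_derivative)

text \<open>The derivative is a rank-one perturbation of the identity, whose determinant is one plus
  the trace of the perturbation.\<close>

lemma push_det:
  fixes e x :: "real^2"
  shows "det (matrix (\<lambda>h. h + (t * (- 4 * max 0 (1 - x \<bullet> x) * (x \<bullet> h))) *\<^sub>R e)) = push_jac t e x"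
  unfolding det_2 matrix_def push_jac_def
  by (simp add: inner_axis axis_def[of 1 "1::real"] axis_def[of 2 "1::real"] inner_vec_def sum_2 algebra_simps)

lemma push_jac_pos:
  assumes "\<bar>t\<bar> * (4 * norm e) \<le> 1/16"
  shows "push_jac t e x > 0"
proof -
  let ?d = "- 4 * max 0 (1 - x \<bullet> x) * (x \<bullet> e)"
  have "\<bar>t * ?d\<bar> \<le> \<bar>t\<bar> * (4 * norm e)"
    unfolding abs_mult[of t ?d] using bump_slope_le by (rule mult_left_mono) simp
  then show ?thesis using assms unfolding push_jac_def by linarith
qed

lemma continuous_push_jac: "continuous_on UNIV (push_jac t e)"
  unfolding push_jac_def by (intro continuous_intros)

lemma continuous_push: "continuous_on UNIV (push t e)"
  by (rule has_derivative_continuous_on[OF has_derivative_at_withinI[OF push_has_derivative]])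

lemma push_inverse:
  fixes e :: "'a::euclidean_space"
  assumes t: "\<bar>t\<bar> * (4 * norm e) \<le> 1/16"
  shows "inv (push t e) (push t e x) = x" "push t e (inv (push t e) x) = x"
  using push_bij[OF t] by (simp_all add: bij_is_inj bij_is_surj surj_f_inv_f)

lemma continuous_push_inverse:
  fixes e :: "'a::euclidean_space"
  assumes t: "\<bar>t\<bar> * (4 * norm e) \<le> 1/16"
  shows "continuous_on A (inv (push t e))"
proof -
  have "2-lipschitz_on A (inv (push t e))"
    using push_expansive[OF t, of "inv (push t e) _" "inv (push t e) _"]
    by (intro lipschitz_onI) (simp_all add: push_inverse[OF t] dist_norm)
  then show ?thesis by (rule lipschitz_on_continuous_on)
qed

lemma nn_integral_push:
  fixes e :: "real^2"
  assumes t: "\<bar>t\<bar> * (4 * norm e) \<le> 1/16" and f: "f \<in> borel_measurable borel"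
  shows "(\<integral>\<^sup>+x. f x \<partial>lborel) = (\<integral>\<^sup>+x. ennreal (push_jac t e x) * f (push t e x) \<partial>lborel)"
  using nn_integral_change_of_variables[OF push_has_derivative push_bij[OF t] _ f, unfolded push_det]
    continuous_push_jac[of t e] less_imp_le[OF push_jac_pos[OF t]] by simp

subsection \<open>Energies as iterated integrals\<close>

text \<open>Covers both terms of the energy: the Gagliardo part has \<open>p = 2 + 2 * s\<close> and
  squared differences as cost \<open>c\<close>, the perimeter has \<open>p = 2 + \<sigma>\<close>
  and the indicator of \<open>E \<times> - E\<close>. The integral is iterated so that variables can
  be changed one at a time.\<close>

definition pair_energy :: "real \<Rightarrow> 'a::euclidean_space set \<Rightarrow> ('a \<Rightarrow> 'a \<Rightarrow> ennreal) \<Rightarrow> ennreal" where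
  "pair_energy p \<Omega> c = (\<integral>\<^sup>+x. \<integral>\<^sup>+y. c x y * ennreal (1 / norm (x - y) powr p) *
      indicator (UNIV - (- \<Omega>) \<times> (- \<Omega>)) (x, y) \<partial>lborel \<partial>lborel)"

text \<open>A Borel integrand has the same integral for the completed measure, and Tonelli applies
  to the uncompleted product.\<close>

lemma nn_integral_lebesgue_pair:
  fixes f :: "'a::euclidean_space \<times> 'b::euclidean_space \<Rightarrow> ennreal"
  assumes [measurable]: "f \<in> borel_measurable (borel \<Otimes>\<^sub>M borel)"
  shows "(\<integral>\<^sup>+z. f z \<partial>lebesgue) = (\<integral>\<^sup>+x. \<integral>\<^sup>+y. f (x, y) \<partial>lborel \<partial>lborel)"
  by (simp add: nn_integral_completion lborel_prod[symmetric] lborel.nn_integral_fst[symmetric])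

lemma pair_domain_measurable [measurable]:
  assumes [measurable]: "\<Omega> \<in> sets borel"
  shows "UNIV - (- \<Omega>) \<times> (- \<Omega>) \<in> sets (borel \<Otimes>\<^sub>M borel)"
proof -
  have "space (borel \<Otimes>\<^sub>M borel) - (- \<Omega>) \<times> (- \<Omega>) \<in> sets (borel \<Otimes>\<^sub>M borel)"
    by measurable
  then show ?thesis by (simp add: space_pair_measure)
qed

lemma gagliardo_eq_pair_energy:
  fixes u :: "real^2 \<Rightarrow> real"
  assumes [measurable]: "u \<in> borel_measurable borel" "\<Omega> \<in> sets borel"
  shows "gagliardo s u (UNIV - (- \<Omega>) \<times> (- \<Omega>)) = pair_energy (2 + 2 * s) \<Omega> (\<lambda>x y. ennreal (\<bar>u x - u y\<bar>\<^sup>2))"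
  unfolding gagliardo_def pair_energy_def
  by (subst nn_integral_lebesgue_pair) (simp_all add: case_prod_beta ennreal_mult'[symmetric])

text \<open>The three interactions are over disjoint sets that make up the part of
  \<open>E \<times> - E\<close> outside \<open>(- \<Omega>) \<times> (- \<Omega>)\<close>.\<close>

lemma frac_perimeter_eq_pair_energy:
  fixes E :: "(real^2) set"
  assumes [measurable]: "E \<in> sets borel" "\<Omega> \<in> sets borel"
  shows "frac_perimeter \<sigma> E \<Omega> = pair_energy (2 + \<sigma>) \<Omega> (\<lambda>x y. indicator E x * indicator (- E) y)"
proof -
  let ?k = "\<lambda>z::(real^2) \<times> (real^2). ennreal (1 / norm (fst z - snd z) powr (2 + \<sigma>))"
  have m: "(\<lambda>z. ?k z * indicator (A \<times> B) z) \<in> borel_measurable lborel"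
    if [measurable]: "A \<in> sets borel" "B \<in> sets borel" for A B
  proof -
    have "(\<lambda>z. ?k z * indicator (A \<times> B) z) \<in> borel_measurable (borel \<Otimes>\<^sub>M borel)"
      by measurable
    then show ?thesis by (simp add: borel_prod)
  qed
  have "frac_perimeter \<sigma> E \<Omega> = (\<integral>\<^sup>+z. ?k z * indicator ((E \<inter> \<Omega>) \<times> (- E \<inter> \<Omega>)) z \<partial>lborel)
     + (\<integral>\<^sup>+z. ?k z * indicator ((E \<inter> \<Omega>) \<times> (- E \<inter> - \<Omega>)) z \<partial>lborel)
     + (\<integral>\<^sup>+z. ?k z * indicator ((E \<inter> - \<Omega>) \<times> (- E \<inter> \<Omega>)) z \<partial>lborel)"
    unfolding frac_perimeter_def interaction_def by (simp add: case_prod_beta nn_integral_completion)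
  also have "\<dots> = (\<integral>\<^sup>+z. ?k z * indicator ((E \<inter> \<Omega>) \<times> (- E \<inter> \<Omega>)) z
     + ?k z * indicator ((E \<inter> \<Omega>) \<times> (- E \<inter> - \<Omega>)) z
     + ?k z * indicator ((E \<inter> - \<Omega>) \<times> (- E \<inter> \<Omega>)) z \<partial>lborel)"
  proof -
    have "A \<inter> B \<in> sets borel" "- A \<in> sets borel"
      if [measurable]: "A \<in> sets borel" "B \<in> sets borel" for A B :: "(real^2) set"
      by auto
    note s = this
    note m1 = m[OF s(1)[OF assms] s(1)[OF s(2)[OF assms(1,1)] assms(2)]]
    note m2 = m[OF s(1)[OF assms] s(1)[OF s(2)[OF assms(1,1)] s(2)[OF assms(2,2)]]]
    note m3 = m[OF s(1)[OF assms(1) s(2)[OF assms(2,2)]] s(1)[OF s(2)[OF assms(1,1)] assms(2)]]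
    show ?thesis
      by (simp only: nn_integral_add[OF borel_measurable_add[OF m1 m2] m3] nn_integral_add[OF m1 m2])
  qed
  also have "\<dots> = (\<integral>\<^sup>+z. indicator E (fst z) * indicator (- E) (snd z) * ?k z *
      indicator (UNIV - (- \<Omega>) \<times> (- \<Omega>)) z \<partial>lborel)"
    by (intro nn_integral_cong) (auto simp: indicator_def)
  also have "\<dots> = pair_energy (2 + \<sigma>) \<Omega> (\<lambda>x y. indicator E x * indicator (- E) y)"
    unfolding pair_energy_def
    by (subst nn_integral_completion[symmetric], subst nn_integral_lebesgue_pair) simp_all
  finally show ?thesis .
qed

lemma pair_energy_mono:
  assumes "\<And>x y. c x y \<le> c' x y"
  shows "pair_energy p \<Omega> c \<le> pair_energy p \<Omega> c'"
  unfolding pair_energy_def using assms by (intro nn_integral_mono mult_right_mono) auto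

lemma pair_energy_add:
  assumes [measurable]: "case_prod c \<in> borel_measurable (borel \<Otimes>\<^sub>M borel)"
    "case_prod c' \<in> borel_measurable (borel \<Otimes>\<^sub>M borel)" "\<Omega> \<in> sets borel"
  shows "pair_energy p \<Omega> (\<lambda>x y. c x y + c' x y) = pair_energy p \<Omega> c + pair_energy p \<Omega> c'"
  unfolding pair_energy_def by (simp add: distrib_right nn_integral_add)

lemma pair_energy_cmult:
  assumes [measurable]: "case_prod c \<in> borel_measurable (borel \<Otimes>\<^sub>M borel)" "\<Omega> \<in> sets borel"
  shows "pair_energy p \<Omega> (\<lambda>x y. a * c x y) = a * pair_energy p \<Omega> c"
  unfolding pair_energy_def by (simp add: mult.assoc nn_integral_cmult)

text \<open>Substituting the push in both variables removes its inverse from the cost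
  \<open>c\<close>, so that all dependence on \<open>t\<close> sits in the kernel and the two
  Jacobians.\<close>

lemma pair_energy_pushforward:
  fixes e :: "real^2"
  assumes t: "\<bar>t\<bar> * (4 * norm e) \<le> 1/16"
    and [measurable]: "case_prod c \<in> borel_measurable (borel \<Otimes>\<^sub>M borel)"
  shows "pair_energy p (ball 0 1) (\<lambda>x y. c (inv (push t e) x) (inv (push t e) y)) =
    (\<integral>\<^sup>+x. \<integral>\<^sup>+y. c x y *
        ennreal (push_jac t e x * push_jac t e y / norm (push t e x - push t e y) powr p) *
        indicator (UNIV - (- ball 0 1) \<times> (- ball 0 1)) (x, y) \<partial>lborel \<partial>lborel)"
proof -
  define S where "S = inv (push t e)"
  have [measurable]: "S \<in> borel_measurable borel" "push t e \<in> borel_measurable borel"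
    "push_jac t e \<in> borel_measurable borel"
    unfolding S_def using continuous_push_inverse[OF t] continuous_push continuous_push_jac
    by (auto intro!: borel_measurable_continuous_onI)
  have S: "S (push t e x) = x" for x by (simp add: S_def push_inverse[OF t])
  let ?F = "\<lambda>x y. c (S x) (S y) * ennreal (1 / norm (x - y) powr p) *
      indicator (UNIV - (- ball 0 1) \<times> (- ball 0 1)) (x, y)"
  have mF[measurable]: "case_prod ?F \<in> borel_measurable (borel \<Otimes>\<^sub>M borel)"
    by measurable
  have "pair_energy p (ball 0 1) (\<lambda>x y. c (S x) (S y)) = (\<integral>\<^sup>+x. \<integral>\<^sup>+y. ?F x y \<partial>lborel \<partial>lborel)"
    by (simp add: pair_energy_def)
  also have "\<dots> = (\<integral>\<^sup>+x. ennreal (push_jac t e x) * (\<integral>\<^sup>+y. ?F (push t e x) y \<partial>lborel) \<partial>lborel)"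
    by (rule nn_integral_push[OF t]) measurable
  also have "\<dots> = (\<integral>\<^sup>+x. ennreal (push_jac t e x) *
      (\<integral>\<^sup>+y. ennreal (push_jac t e y) * ?F (push t e x) (push t e y) \<partial>lborel) \<partial>lborel)"
    by (intro nn_integral_cong arg_cong2[of _ _ _ _ "(*)"] refl nn_integral_push[OF t]) measurable
  also have "\<dots> = (\<integral>\<^sup>+x. \<integral>\<^sup>+y. ennreal (push_jac t e x) *
      (ennreal (push_jac t e y) * ?F (push t e x) (push t e y)) \<partial>lborel \<partial>lborel)"
    by (intro nn_integral_cong nn_integral_cmult[symmetric]) measurable
  also have "\<dots> = (\<integral>\<^sup>+x. \<integral>\<^sup>+y. c x y *
        ennreal (push_jac t e x * push_jac t e y / norm (push t e x - push t e y) powr p) *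
        indicator (UNIV - (- ball 0 1) \<times> (- ball 0 1)) (x, y) \<partial>lborel \<partial>lborel)"
  proof (intro nn_integral_cong)
    fix x y :: "real^2"
    have i: "indicator (UNIV - (- ball 0 1) \<times> (- ball 0 1)) (push t e x, push t e y)
       = (indicator (UNIV - (- ball 0 1) \<times> (- ball 0 1)) (x, y) :: ennreal)"
      using push_mem_ball[OF t, of x] push_mem_ball[OF t, of y] by (simp add: indicator_def)
    have "ennreal (push_jac t e x * push_jac t e y / norm (push t e x - push t e y) powr p)
      = ennreal (push_jac t e x) * ennreal (push_jac t e y) * ennreal (1 / norm (push t e x - push t e y) powr p)"
      using push_jac_pos[OF t, of x] push_jac_pos[OF t, of y]
      by (simp add: ennreal_mult[symmetric])
    then show "ennreal (push_jac t e x) * (ennreal (push_jac t e y) * ?F (push t e x) (push t e y)) =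
      c x y * ennreal (push_jac t e x * push_jac t e y / norm (push t e x - push t e y) powr p) *
        indicator (UNIV - (- ball 0 1) \<times> (- ball 0 1)) (x, y)"
      unfolding i S by (simp add: mult_ac)
  qed
  finally show ?thesis unfolding S_def .
qed

lemma pair_energy_second_variation:
  fixes e :: "real^2"
  assumes t: "\<bar>t\<bar> * (4 * norm e) \<le> 1/16" and p: "0 \<le> p" "p \<le> 4"
    and [measurable]: "case_prod c \<in> borel_measurable (borel \<Otimes>\<^sub>M borel)"
  shows "pair_energy p (ball 0 1) (\<lambda>x y. c (inv (push t e) x) (inv (push t e) y)) +
      pair_energy p (ball 0 1) (\<lambda>x y. c (inv (push (- t) e) x) (inv (push (- t) e) y))
    \<le> ennreal (2 + 400 * (t * (4 * norm e))\<^sup>2) * pair_energy p (ball 0 1) c"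
proof -
  have t': "\<bar>- t\<bar> * (4 * norm e) \<le> 1/16" using t by simp
  let ?C = "2 + 400 * (t * (4 * norm e))\<^sup>2"
  let ?I = "\<lambda>x y. indicator (UNIV - (- ball 0 1) \<times> (- ball 0 (1::real))) (x::real^2, y::real^2) :: ennreal"
  let ?G = "\<lambda>t x y. push_jac t e x * push_jac t e y / norm (push t e x - push t e y) powr p"
  have m[measurable]: "push t e \<in> borel_measurable borel" "push_jac t e \<in> borel_measurable borel" for t
    using continuous_push continuous_push_jac by (auto intro!: borel_measurable_continuous_onI)
  have k: "?G t x y + ?G (- t) x y \<le> ?C * (1 / norm (x - y) powr p)" for x y
  proof -
    have "norm ((bump x - bump y) *\<^sub>R e) \<le> 4 * norm e * norm (x - y)" by (rule bump_diff_norm)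
    \<comment> \<open>Here \<open>M = 4 * norm e\<close> serves both as the Lipschitz constant of
      the displacement and as the bound on the slopes in the Jacobians.\<close>
    from kernel_second_variation[OF this, of "p/2" _ _ t, OF _ _ bump_slope_le[of x e] bump_slope_le[of y e]]
    show ?thesis using p t unfolding push_diff push_jac_def by simp
  qed
  have "pair_energy p (ball 0 1) (\<lambda>x y. c (inv (push t e) x) (inv (push t e) y)) +
      pair_energy p (ball 0 1) (\<lambda>x y. c (inv (push (- t) e) x) (inv (push (- t) e) y))
    = (\<integral>\<^sup>+x. \<integral>\<^sup>+y. c x y * ennreal (?G t x y) * ?I x y + c x y * ennreal (?G (- t) x y) * ?I x y \<partial>lborel \<partial>lborel)"
    unfolding pair_energy_pushforward[OF t \<open>case_prod c \<in> _\<close>] pair_energy_pushforward[OF t' \<open>case_prod c \<in> _\<close>]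
    by (simp add: nn_integral_add)
  also have "\<dots> \<le> (\<integral>\<^sup>+x. \<integral>\<^sup>+y. (ennreal ?C * c x y) * ennreal (1 / norm (x - y) powr p) * ?I x y \<partial>lborel \<partial>lborel)"
  proof (intro nn_integral_mono)
    fix x y :: "real^2"
    have "0 \<le> ?G t x y" "0 \<le> ?G (- t) x y"
      using push_jac_pos[OF t] push_jac_pos[OF t'] by (simp_all add: less_imp_le)
    then have "ennreal (?G t x y) + ennreal (?G (- t) x y) = ennreal (?G t x y + ?G (- t) x y)"
      by (rule ennreal_plus[symmetric])
    also have "\<dots> \<le> ennreal (?C * (1 / norm (x - y) powr p))" by (rule ennreal_leI[OF k])
    also have "\<dots> = ennreal ?C * ennreal (1 / norm (x - y) powr p)" by (rule ennreal_mult) auto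
    finally have "c x y * (ennreal (?G t x y) + ennreal (?G (- t) x y)) * ?I x y
      \<le> c x y * (ennreal ?C * ennreal (1 / norm (x - y) powr p)) * ?I x y"
      by (intro mult_right_mono mult_left_mono) auto
    then show "c x y * ennreal (?G t x y) * ?I x y + c x y * ennreal (?G (- t) x y) * ?I x y
      \<le> (ennreal ?C * c x y) * ennreal (1 / norm (x - y) powr p) * ?I x y"
      by (simp add: distrib_left distrib_right mult_ac)
  qed
  also have "\<dots> = pair_energy p (ball 0 1) (\<lambda>x y. ennreal ?C * c x y)"
    by (simp add: pair_energy_def)
  also have "\<dots> = ennreal ?C * pair_energy p (ball 0 1) c"
    by (rule pair_energy_cmult) measurable
  finally show ?thesis .
qed

subsection \<open>Submodularity and competitors\<close>

lemma energy_eq_pair_energy: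
  fixes u :: "real^2 \<Rightarrow> real"
  assumes "u \<in> borel_measurable borel" "E \<in> sets borel" "\<Omega> \<in> sets borel"
  shows "energy s \<sigma> \<Omega> u E = pair_energy (2 + 2 * s) \<Omega> (\<lambda>x y. ennreal (\<bar>u x - u y\<bar>\<^sup>2))
    + pair_energy (2 + \<sigma>) \<Omega> (\<lambda>x y. indicator E x * indicator (- E) y)"
  unfolding energy_def using assms
  by (simp add: gagliardo_eq_pair_energy frac_perimeter_eq_pair_energy)

text \<open>If the two pairs are ordered alike, equality holds; if they are ordered oppositely,
  exchanging partners changes the sum by \<open>2 * (a - b) * (c - d)\<close>, which is not
  positive.\<close>

lemma max_min_square_le:
  fixes a b c d :: real
  shows "\<bar>max a b - max c d\<bar>\<^sup>2 + \<bar>min a b - min c d\<bar>\<^sup>2 \<le> \<bar>a - c\<bar>\<^sup>2 + \<bar>b - d\<bar>\<^sup>2"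
proof -
  have *: "(a - d)\<^sup>2 + (b - c)\<^sup>2 \<le> (a - c)\<^sup>2 + (b - d)\<^sup>2" if "(a - b) * (c - d) \<le> 0"
    using that by (simp add: power2_eq_square algebra_simps)
  show ?thesis
  proof (cases "a \<le> b"; cases "c \<le> d")
    assume "a \<le> b" "\<not> c \<le> d"
    then show ?thesis using * by (simp add: mult_nonpos_nonneg)
  next
    assume "\<not> a \<le> b" "c \<le> d"
    then show ?thesis using * by (simp add: mult_nonneg_nonpos)
  qed simp_all
qed

lemma energy_submodular:
  fixes u w :: "real^2 \<Rightarrow> real"
  assumes [measurable]: "u \<in> borel_measurable borel" "w \<in> borel_measurable borel"
      "E \<in> sets borel" "F \<in> sets borel" "\<Omega> \<in> sets borel" "A \<in> sets borel" "B \<in> sets borel"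
    and AB: "A \<subseteq> E - F" "B \<subseteq> F - E"
  shows "energy s \<sigma> \<Omega> (\<lambda>x. max (u x) (w x)) (E \<union> F) + energy s \<sigma> \<Omega> (\<lambda>x. min (u x) (w x)) (E \<inter> F)
      + pair_energy (2 + \<sigma>) \<Omega> (\<lambda>x y. indicator A x * indicator B y)
    \<le> energy s \<sigma> \<Omega> u E + energy s \<sigma> \<Omega> w F"
proof -
  let ?g = "\<lambda>(u::real^2 \<Rightarrow> real) x y. ennreal (\<bar>u x - u y\<bar>\<^sup>2)"
  let ?i = "\<lambda>E x (y::real^2). indicator E x * indicator (- E) y :: ennreal"
  let ?G = "\<lambda>u. pair_energy (2 + 2 * s) \<Omega> (?g u)"
  let ?P = "\<lambda>E. pair_energy (2 + \<sigma>) \<Omega> (?i E)"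
  let ?L = "pair_energy (2 + \<sigma>) \<Omega> (\<lambda>x y. indicator A x * indicator B y)"
  have "?G (\<lambda>x. max (u x) (w x)) + ?G (\<lambda>x. min (u x) (w x))
      = pair_energy (2 + 2 * s) \<Omega> (\<lambda>x y. ?g (\<lambda>x. max (u x) (w x)) x y + ?g (\<lambda>x. min (u x) (w x)) x y)"
    by (rule pair_energy_add[symmetric]) measurable
  also have "\<dots> \<le> pair_energy (2 + 2 * s) \<Omega> (\<lambda>x y. ?g u x y + ?g w x y)"
    using max_min_square_le
    by (intro pair_energy_mono) (simp add: ennreal_plus[symmetric] ennreal_leI del: ennreal_plus)
  also have "\<dots> = ?G u + ?G w"
    by (rule pair_energy_add) measurable
  finally have G: "?G (\<lambda>x. max (u x) (w x)) + ?G (\<lambda>x. min (u x) (w x)) \<le> ?G u + ?G w" .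
  have "?P (E \<union> F) + ?P (E \<inter> F)
      = pair_energy (2 + \<sigma>) \<Omega> (\<lambda>x y. ?i (E \<union> F) x y + ?i (E \<inter> F) x y)"
    by (rule pair_energy_add[symmetric]) measurable
  then have "?P (E \<union> F) + ?P (E \<inter> F) + ?L
      = pair_energy (2 + \<sigma>) \<Omega> (\<lambda>x y. ?i (E \<union> F) x y + ?i (E \<inter> F) x y) + ?L"
    by (simp only:)
  also have "\<dots> = pair_energy (2 + \<sigma>) \<Omega> (\<lambda>x y. ?i (E \<union> F) x y + ?i (E \<inter> F) x y + indicator A x * indicator B y)"
    by (rule pair_energy_add[symmetric]) measurable
  \<comment> \<open>The gain: a pair in \<open>A \<times> B\<close> is charged to \<open>E\<close>,
    but neither to the union, which contains both points, nor to the intersection, which contains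
    neither.\<close>
  also have "\<dots> \<le> pair_energy (2 + \<sigma>) \<Omega> (\<lambda>x y. ?i E x y + ?i F x y)"
    using AB by (intro pair_energy_mono) (auto simp: indicator_def)
  also have "\<dots> = ?P E + ?P F"
    by (rule pair_energy_add) measurable
  finally have P: "?P (E \<union> F) + ?P (E \<inter> F) + ?L \<le> ?P E + ?P F" .
  have "energy s \<sigma> \<Omega> (\<lambda>x. max (u x) (w x)) (E \<union> F) + energy s \<sigma> \<Omega> (\<lambda>x. min (u x) (w x)) (E \<inter> F) + ?L
      = (?G (\<lambda>x. max (u x) (w x)) + ?G (\<lambda>x. min (u x) (w x))) + (?P (E \<union> F) + ?P (E \<inter> F) + ?L)"
    by (simp add: energy_eq_pair_energy add_ac)
  also have "\<dots> \<le> (?G u + ?G w) + (?P E + ?P F)"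
    by (rule add_mono[OF G P])
  also have "\<dots> = energy s \<sigma> \<Omega> u E + energy s \<sigma> \<Omega> w F"
    by (simp add: energy_eq_pair_energy add_ac)
  finally show ?thesis .
qed

section \<open>Sobolev membership and admissibility of competitors\<close>

text \<open>No measurability of \<open>f\<close> is required: the integral of a non-measurable function is a lower
  integral. This spares the measurability of \<open>(x, y) \<mapsto> \<phi> x\<close> for Lebesgue measurable \<open>\<phi>\<close>.\<close>

lemma nn_integral_le_double_plus:
  fixes f g h :: "'a \<Rightarrow> ennreal"
  assumes g: "g \<in> borel_measurable M" and le: "\<And>x. h x \<le> 2 * f x + g x"
  shows "(\<integral>\<^sup>+x. h x \<partial>M) \<le> 2 * (\<integral>\<^sup>+x. f x \<partial>M) + (\<integral>\<^sup>+x. g x \<partial>M)"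
  unfolding nn_integral_def_finite[of M h]
proof (rule SUP_least, clarify)
  \<comment> \<open>Restricting to finite simple functions keeps \<open>top - top\<close>, which is
    \<open>top\<close>, out of the subtraction below.\<close>
  fix k assume k: "simple_function M k" "k \<le> h" "\<forall>x. k x < top"
  \<comment> \<open>A measurable minorant of \<open>f\<close> extracted from \<open>k\<close>.
    Subtraction is truncated: where \<open>g\<close> exceeds \<open>k\<close> it gives 0, and
    \<open>k \<le> g\<close> suffices there.\<close>
  define r where "r = (\<lambda>x. ennreal (1/2) * (k x - g x))"
  have [measurable]: "k \<in> borel_measurable M" "g \<in> borel_measurable M"
    using k g by (auto intro: borel_measurable_simple_function)
  have [measurable]: "r \<in> borel_measurable M" unfolding r_def by measurable
  have half: "ennreal (1/2) * 2 = 1" "2 * ennreal (1/2) = 1"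
    using ennreal_mult[of "1/2" 2] ennreal_mult[of 2 "1/2"] by simp_all
  have "k x \<le> 2 * f x + g x" for x using k(2) le by (meson le_funD order.trans)
  then have "k x - g x \<le> 2 * f x" for x
    using k(3)[rule_format, of x] by (auto simp: ennreal_minus_le_iff add.commute)
  then have "r x \<le> ennreal (1/2) * (2 * f x)" for x
    unfolding r_def by (intro mult_left_mono) auto
  moreover have "ennreal (1/2) * (2 * f x) = f x" for x by (metis half(1) mult.assoc mult_1)
  ultimately have r: "r x \<le> f x" for x by metis
  have "k x \<le> 2 * r x + g x" for x
    unfolding r_def mult.assoc[symmetric] half
    by (cases "g x \<le> k x") (auto simp: diff_add_cancel_ennreal intro: add_increasing)
  then have "(\<integral>\<^sup>+x. k x \<partial>M) \<le> (\<integral>\<^sup>+x. 2 * r x + g x \<partial>M)" by (intro nn_integral_mono)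
  also have "\<dots> = 2 * (\<integral>\<^sup>+x. r x \<partial>M) + (\<integral>\<^sup>+x. g x \<partial>M)"
    by (simp add: nn_integral_add nn_integral_cmult)
  also have "\<dots> \<le> 2 * (\<integral>\<^sup>+x. f x \<partial>M) + (\<integral>\<^sup>+x. g x \<partial>M)"
    using r by (intro add_mono mult_left_mono nn_integral_mono) auto
  finally show "integral\<^sup>S M k \<le> 2 * (\<integral>\<^sup>+x. f x \<partial>M) + (\<integral>\<^sup>+x. g x \<partial>M)"
    using k(1) by (simp add: nn_integral_eq_simple_integral)
qed

lemma square_add_le: "(a + b)\<^sup>2 \<le> 2 * a\<^sup>2 + 2 * (b::real)\<^sup>2"
  using zero_le_power2[of "a - b"] by (simp add: power2_eq_square algebra_simps)

text \<open>To be applied with \<open>f\<close> the difference of \<open>u\<close> and the exterior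
  datum, which is known to be Lebesgue measurable, and \<open>g\<close> a difference of Borel
  functions.\<close>

lemma in_Hs_add:
  fixes f g :: "real^2 \<Rightarrow> real"
  assumes f: "in_Hs s UNIV f" and g: "in_Hs s UNIV g" and [measurable]: "g \<in> borel_measurable borel"
  shows "in_Hs s UNIV (\<lambda>x. f x + g x)"
proof -
  have ml: "f \<in> borel_measurable lebesgue" "g \<in> borel_measurable lebesgue"
    using f g by (auto simp: in_Hs_def lebesgue_on_UNIV_eq)
  have mg: "(\<lambda>x. ennreal ((g x)\<^sup>2)) \<in> borel_measurable lebesgue"
    by (rule measurable_completion) measurable
  have "(\<integral>\<^sup>+x. ennreal ((f x + g x)\<^sup>2) \<partial>lebesgue)
      \<le> 2 * (\<integral>\<^sup>+x. ennreal ((f x)\<^sup>2) \<partial>lebesgue) + (\<integral>\<^sup>+x. 2 * ennreal ((g x)\<^sup>2) \<partial>lebesgue)"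
  proof (rule nn_integral_le_double_plus)
    show "ennreal ((f x + g x)\<^sup>2) \<le> 2 * ennreal ((f x)\<^sup>2) + 2 * ennreal ((g x)\<^sup>2)" for x
      using square_add_le[of "f x" "g x"]
      by (simp add: ennreal_mult[symmetric] ennreal_plus[symmetric] ennreal_leI
          del: ennreal_plus flip: ennreal_numeral)
  qed (rule borel_measurable_times_ennreal[OF borel_measurable_const mg])
  also have "(\<integral>\<^sup>+x. 2 * ennreal ((g x)\<^sup>2) \<partial>lebesgue) = 2 * (\<integral>\<^sup>+x. ennreal ((g x)\<^sup>2) \<partial>lebesgue)"
    by (rule nn_integral_cmult[OF mg])
  also have "2 * (\<integral>\<^sup>+x. ennreal ((f x)\<^sup>2) \<partial>lebesgue) + 2 * (\<integral>\<^sup>+x. ennreal ((g x)\<^sup>2) \<partial>lebesgue) < \<infinity>"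
    using f g by (simp add: in_Hs_def ennreal_mult_less_top)
  finally have L2: "(\<integral>\<^sup>+x. ennreal ((f x + g x)\<^sup>2) \<partial>lebesgue) < \<infinity>" .
  let ?k = "\<lambda>(h::real^2 \<Rightarrow> real) z. ennreal (\<bar>h (fst z) - h (snd z)\<bar>\<^sup>2 / norm (fst z - snd z) powr (2 + 2 * s))"
  have G: "gagliardo s h (UNIV \<times> UNIV) = (\<integral>\<^sup>+z. ?k h z \<partial>lborel)" for h :: "real^2 \<Rightarrow> real"
    by (simp add: gagliardo_def case_prod_beta nn_integral_completion)
  have m: "?k g \<in> borel_measurable lborel"
  proof -
    have "?k g \<in> borel_measurable (borel \<Otimes>\<^sub>M borel)" by measurable
    then show ?thesis by (simp add: borel_prod)
  qed
  have "(\<integral>\<^sup>+z. ?k (\<lambda>x. f x + g x) z \<partial>lborel) \<le> 2 * (\<integral>\<^sup>+z. ?k f z \<partial>lborel) + (\<integral>\<^sup>+z. 2 * ?k g z \<partial>lborel)"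
  proof (rule nn_integral_le_double_plus)
    fix z :: "(real^2) \<times> (real^2)"
    have "(f (fst z) + g (fst z) - (f (snd z) + g (snd z)))\<^sup>2
       \<le> 2 * (f (fst z) - f (snd z))\<^sup>2 + 2 * (g (fst z) - g (snd z))\<^sup>2"
      using square_add_le[of "f (fst z) - f (snd z)" "g (fst z) - g (snd z)"] by (simp add: algebra_simps)
    then have "(f (fst z) + g (fst z) - (f (snd z) + g (snd z)))\<^sup>2 / norm (fst z - snd z) powr (2 + 2 * s)
       \<le> (2 * (f (fst z) - f (snd z))\<^sup>2 + 2 * (g (fst z) - g (snd z))\<^sup>2) / norm (fst z - snd z) powr (2 + 2 * s)"
      by (rule divide_right_mono) simp
    then show "?k (\<lambda>x. f x + g x) z \<le> 2 * ?k f z + 2 * ?k g z"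
      by (simp add: ennreal_mult[symmetric] ennreal_plus[symmetric] ennreal_leI add_divide_distrib
          del: ennreal_plus flip: ennreal_numeral)
  qed (rule borel_measurable_times_ennreal[OF borel_measurable_const m])
  also have "(\<integral>\<^sup>+z. 2 * ?k g z \<partial>lborel) = 2 * (\<integral>\<^sup>+z. ?k g z \<partial>lborel)"
    using m by (rule nn_integral_cmult)
  also have "2 * (\<integral>\<^sup>+z. ?k f z \<partial>lborel) + 2 * (\<integral>\<^sup>+z. ?k g z \<partial>lborel) < \<infinity>"
  proof -
    have "(\<integral>\<^sup>+z. ?k f z \<partial>lborel) < \<infinity>" "(\<integral>\<^sup>+z. ?k g z \<partial>lborel) < \<infinity>"
      using f g unfolding in_Hs_def G by blast+
    then show ?thesis by (simp only: ennreal_mult_less_top ennreal_add_less_top infinity_ennreal_def) simp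
  qed
  finally have "gagliardo s (\<lambda>x. f x + g x) (UNIV \<times> UNIV) < \<infinity>" unfolding G .
  then show ?thesis using L2 ml by (simp add: in_Hs_def lebesgue_on_UNIV_eq)
qed

text \<open>The difference is bounded and vanishes outside the ball, hence is square integrable.
  Pairs with both points outside contribute nothing to its seminorm, and the remaining ones are
  controlled by the energies of \<open>u\<close> and \<open>v\<close>.\<close>

lemma in_Hs_diff_competitor:
  fixes u v :: "real^2 \<Rightarrow> real"
  assumes [measurable]: "u \<in> borel_measurable borel" "v \<in> borel_measurable borel"
    and out: "\<And>x. x \<notin> ball 0 1 \<Longrightarrow> v x = u x" and bd: "\<And>x. \<bar>v x - u x\<bar> \<le> C"
    and fin: "gagliardo s u (UNIV - (- ball 0 1) \<times> (- ball 0 1)) < \<infinity>"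
      "gagliardo s v (UNIV - (- ball 0 1) \<times> (- ball 0 1)) < \<infinity>"
  shows "in_Hs s UNIV (\<lambda>x. v x - u x)"
proof -
  let ?w = "\<lambda>x. v x - u x"
  have m: "?w \<in> borel_measurable lebesgue"
    by (rule measurable_completion) measurable
  have "(\<integral>\<^sup>+x. ennreal ((?w x)\<^sup>2) \<partial>lebesgue) \<le> (\<integral>\<^sup>+x. ennreal (C\<^sup>2) * indicator (ball (0::real^2) 1) x \<partial>lborel)"
    unfolding nn_integral_completion
  proof (intro nn_integral_mono)
    fix x
    have "(?w x)\<^sup>2 \<le> C\<^sup>2" using bd[of x] by (metis abs_ge_zero power2_abs power_mono)
    then show "ennreal ((?w x)\<^sup>2) \<le> ennreal (C\<^sup>2) * indicator (ball 0 1) x"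
      using out[of x] by (auto simp: indicator_def ennreal_leI)
  qed
  also have "\<dots> = ennreal (C\<^sup>2) * emeasure lborel (ball (0::real^2) 1)"
    by (rule nn_integral_cmult_indicator) simp
  also have "\<dots> < \<infinity>"
    using emeasure_bounded_finite[OF bounded_ball, of "0::real^2" 1]
    by (simp add: ennreal_mult_less_top)
  finally have L2: "(\<integral>\<^sup>+x. ennreal ((?w x)\<^sup>2) \<partial>lebesgue) < \<infinity>" .
  let ?g = "\<lambda>(u::real^2 \<Rightarrow> real) x y. ennreal (\<bar>u x - u y\<bar>\<^sup>2)"
  let ?Q = "UNIV - (- ball 0 1) \<times> (- ball (0::real^2) (1::real))"
  have "gagliardo s ?w (UNIV \<times> UNIV) = gagliardo s ?w ?Q"
    unfolding gagliardo_def using out by (intro nn_integral_cong) (auto simp: indicator_def)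
  also have "\<dots> = pair_energy (2 + 2 * s) (ball 0 1) (?g ?w)"
    by (rule gagliardo_eq_pair_energy) measurable
  also have "\<dots> \<le> pair_energy (2 + 2 * s) (ball 0 1) (\<lambda>x y. 2 * ?g u x y + 2 * ?g v x y)"
  proof (rule pair_energy_mono)
    fix x y
    have "(?w x - ?w y)\<^sup>2 \<le> 2 * (u x - u y)\<^sup>2 + 2 * (v x - v y)\<^sup>2"
      using square_add_le[of "v x - v y" "u y - u x"] by (simp add: algebra_simps power2_commute)
    then show "?g ?w x y \<le> 2 * ?g u x y + 2 * ?g v x y"
      by (simp add: ennreal_mult[symmetric] ennreal_plus[symmetric] ennreal_leI
          del: ennreal_plus flip: ennreal_numeral)
  qed
  also have "\<dots> = 2 * pair_energy (2 + 2 * s) (ball 0 1) (?g u) + 2 * pair_energy (2 + 2 * s) (ball 0 1) (?g v)"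
    by (simp add: pair_energy_add pair_energy_cmult)
  also have "\<dots> < \<infinity>"
    using fin by (simp add: gagliardo_eq_pair_energy ennreal_mult_less_top)
  finally show ?thesis using L2 m by (simp add: in_Hs_def lebesgue_on_UNIV_eq)
qed

lemma admissible_competitor:
  fixes u v :: "real^2 \<Rightarrow> real"
  assumes adm: "admissible s (ball 0 1) \<phi> E\<^sub>0 u E"
    and [measurable]: "u \<in> borel_measurable borel" "v \<in> borel_measurable borel" and F: "F \<in> sets borel"
    and out: "\<And>x. x \<notin> ball 0 1 \<Longrightarrow> v x = u x" and bd: "\<And>x. \<bar>v x - u x\<bar> \<le> C"
    and fin: "gagliardo s u (UNIV - (- ball 0 1) \<times> (- ball 0 1)) < \<infinity>"
      "gagliardo s v (UNIV - (- ball 0 1) \<times> (- ball 0 1)) < \<infinity>"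
    and FE: "F - ball 0 1 = E - ball 0 1"
    and sgn: "\<And>x. x \<in> F \<Longrightarrow> v x \<ge> 0" "\<And>x. x \<notin> F \<Longrightarrow> v x \<le> 0"
  shows "admissible s (ball 0 1) \<phi> E\<^sub>0 v F"
proof -
  \<comment> \<open>The route to \<open>v - \<phi>\<close> goes through \<open>u\<close>, whose own
    difference from \<open>\<phi>\<close> is in the space by admissibility.\<close>
  have "in_Hs s UNIV (\<lambda>x. (u x - \<phi> x) + (v x - u x))"
    using adm by (intro in_Hs_add in_Hs_diff_competitor[OF _ _ out bd fin])
      (simp_all add: admissible_def)
  then have "in_Hs s UNIV (\<lambda>x. v x - \<phi> x)" by simp
  moreover have "AE x in lebesgue. x \<in> - ball 0 1 \<longrightarrow> v x = \<phi> x"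
    using adm out unfolding admissible_def by (auto elim!: AE_mp[rotated] eventually_mono)
  ultimately show ?thesis
    using adm F FE sgn unfolding admissible_def by auto
qed

section \<open>Minimality tested against the pushed pair\<close>

lemma push_inverse_mem_ball:
  fixes e :: "'a::euclidean_space"
  assumes t: "\<bar>t\<bar> * (4 * norm e) \<le> 1/16"
  shows "inv (push t e) x \<in> ball 0 1 \<longleftrightarrow> x \<in> ball 0 1"
  using push_mem_ball[OF t, of "inv (push t e) x"] push_inverse(2)[OF t, of x] by simp

lemma push_inverse_outside:
  fixes e :: "'a::euclidean_space"
  assumes t: "\<bar>t\<bar> * (4 * norm e) \<le> 1/16" and x: "x \<notin> ball 0 1"
  shows "inv (push t e) x = x"
  using push_outside[of x t e] push_inverse(1)[OF t, of x] x by simp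

lemma energy_second_variation:
  fixes u :: "real^2 \<Rightarrow> real"
  assumes s: "0 < s" "s < 1" and \<sigma>: "0 < \<sigma>" "\<sigma> < 1" and t: "\<bar>t\<bar> * (4 * norm e) \<le> 1/16"
    and [measurable]: "u \<in> borel_measurable borel" "E \<in> sets borel"
  shows "energy s \<sigma> (ball 0 1) (\<lambda>x. u (inv (push t e) x)) (inv (push t e) -` E)
      + energy s \<sigma> (ball 0 1) (\<lambda>x. u (inv (push (- t) e) x)) (inv (push (- t) e) -` E)
    \<le> ennreal (2 + 400 * (t * (4 * norm e))\<^sup>2) * energy s \<sigma> (ball 0 1) u E"
proof -
  have t': "\<bar>- t\<bar> * (4 * norm e) \<le> 1/16" using t by simp
  have S[measurable]: "inv (push t e) \<in> borel_measurable borel" "inv (push (- t) e) \<in> borel_measurable borel"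
    using continuous_push_inverse[OF t] continuous_push_inverse[OF t']
    by (auto intro!: borel_measurable_continuous_onI)
  have E: "inv (push t e) -` E \<in> sets borel" "inv (push (- t) e) -` E \<in> sets borel"
    using measurable_sets_borel[OF S(1)] measurable_sets_borel[OF S(2)] by auto
  have us: "(\<lambda>x. u (inv (push t e) x)) \<in> borel_measurable borel"
      "(\<lambda>x. u (inv (push (- t) e) x)) \<in> borel_measurable borel"
    by measurable
  let ?C = "ennreal (2 + 400 * (t * (4 * norm e))\<^sup>2)"
  let ?g = "\<lambda>x y. ennreal (\<bar>u x - u y\<bar>\<^sup>2)"
  let ?i = "\<lambda>x y. indicator E x * indicator (- E) y :: ennreal"
  let ?pe = "\<lambda>p. pair_energy p (ball 0 1)"
  let ?pt = "\<lambda>p c t. ?pe p (\<lambda>x y. c (inv (push t e) x) (inv (push t e) y))"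
  have G: "?pt (2 + 2 * s) ?g t + ?pt (2 + 2 * s) ?g (- t) \<le> ?C * ?pe (2 + 2 * s) ?g"
    by (rule pair_energy_second_variation[OF t]) (use s in simp, use s in simp, measurable)
  have P: "?pt (2 + \<sigma>) ?i t + ?pt (2 + \<sigma>) ?i (- t) \<le> ?C * ?pe (2 + \<sigma>) ?i"
    by (rule pair_energy_second_variation[OF t]) (use \<sigma> in simp, use \<sigma> in simp, measurable)
  have ind: "indicator (f -` A) x = (indicator A (f x) :: ennreal)"
      "indicator (- (f -` A)) x = (indicator (- A) (f x) :: ennreal)" for f :: "real^2 \<Rightarrow> real^2" and A x
    by (simp_all add: indicator_def)
  have "energy s \<sigma> (ball 0 1) (\<lambda>x. u (inv (push t e) x)) (inv (push t e) -` E)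
      + energy s \<sigma> (ball 0 1) (\<lambda>x. u (inv (push (- t) e) x)) (inv (push (- t) e) -` E)
    = (?pt (2 + 2 * s) ?g t + ?pt (2 + 2 * s) ?g (- t)) + (?pt (2 + \<sigma>) ?i t + ?pt (2 + \<sigma>) ?i (- t))"
    by (simp add: energy_eq_pair_energy[OF us(1) E(1)] energy_eq_pair_energy[OF us(2) E(2)] ind add_ac)
  also have "\<dots> \<le> ?C * ?pe (2 + 2 * s) ?g + ?C * ?pe (2 + \<sigma>) ?i"
    by (rule add_mono[OF G P])
  also have "\<dots> = ?C * energy s \<sigma> (ball 0 1) u E"
    by (simp add: energy_eq_pair_energy distrib_left)
  finally show ?thesis .
qed

lemma gagliardo_le_energy: "gagliardo s u (UNIV - (- \<Omega>) \<times> (- \<Omega>)) \<le> energy s \<sigma> \<Omega> u E"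
  by (simp add: energy_def)

text \<open>Here \<open>m\<close> is the minimal energy, \<open>a\<close> and \<open>b\<close>
  belong to the pushes by \<open>t\<close> and \<open>- t\<close>, and \<open>p\<close> and
  \<open>q\<close> to the maximum and the minimum. Over the reals, \<open>sub\<close> and
  \<open>pq\<close> give \<open>L \<le> a - m\<close>, while \<open>ab\<close> and \<open>b\<close>
  give \<open>a \<le> (1 + c) * m\<close>. With extended values, everything is added up first and
  cancelled once \<open>L\<close> is known to be finite.\<close>

lemma ennreal_cancel_energies:
  fixes m c :: real and a b p q L :: ennreal
  assumes m: "0 \<le> m" and c: "0 \<le> c"
    and ab: "a + b \<le> ennreal (2 + c) * ennreal m" and b: "ennreal m \<le> b"
    and pq: "ennreal m \<le> p" "ennreal m \<le> q" and sub: "p + q + L \<le> ennreal m + a"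
  shows "L \<le> ennreal (c * m)"
proof -
  have "ennreal m + (ennreal m + L) + ennreal m = ennreal m + ennreal m + L + ennreal m"
    by (simp add: add_ac)
  also have "\<dots> \<le> p + q + L + b" using pq b by (intro add_mono) auto
  also have "\<dots> \<le> ennreal m + a + b" by (rule add_right_mono[OF sub])
  also have "\<dots> \<le> ennreal m + ennreal (2 + c) * ennreal m"
    using ab by (simp add: add.assoc add_left_mono)
  also have "\<dots> = ennreal (m + (2 + c) * m)"
    using m c by (simp add: ennreal_mult[symmetric] ennreal_plus[symmetric] del: ennreal_plus)
  finally have *: "ennreal m + (ennreal m + L) + ennreal m \<le> ennreal (m + (2 + c) * m)" .
  then obtain l where l: "L = ennreal l" "0 \<le> l"
    by (cases L) (auto simp: top_unique)
  show ?thesis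
    using * m c unfolding l(1)
    by (simp add: ennreal_plus[symmetric] l ennreal_le_iff algebra_simps del: ennreal_plus)
qed

text \<open>The constant \<open>m\<close> is the energy of \<open>(u, E)\<close>, finite because the
  external data admit a pair of finite energy. Minimality is tested against three competitors: the
  push by \<open>- t\<close>, the maximum with the union, and the minimum with the
  intersection.\<close>

lemma interaction_bound:
  fixes u :: "real^2 \<Rightarrow> real"
  assumes s: "0 < s" "s < 1" and \<sigma>: "0 < \<sigma>" "\<sigma> < 1"
    and min: "minimizing_pair s \<sigma> (ball 0 1) u E"
    and cont: "continuous_on UNIV u" and E[measurable]: "E \<in> sets borel"
    and sgn: "\<And>x. x \<in> E \<Longrightarrow> u x \<ge> 0" "\<And>x. x \<notin> E \<Longrightarrow> u x \<le> 0"
  obtains m where "0 \<le> m" and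
    "\<And>t e A B. \<lbrakk>\<bar>t\<bar> * (4 * norm e) \<le> 1/16; A \<in> sets borel; B \<in> sets borel;
        A \<subseteq> E - inv (push t e) -` E; B \<subseteq> inv (push t e) -` E - E\<rbrakk>
      \<Longrightarrow> pair_energy (2 + \<sigma>) (ball 0 1) (\<lambda>x y. indicator A x * indicator B y)
        \<le> ennreal (400 * (t * (4 * norm e))\<^sup>2 * m)"
proof -
  let ?B = "ball (0::real^2) 1"
  let ?en = "energy s \<sigma> ?B"
  obtain \<phi> E\<^sub>0 where data: "external_data s \<sigma> ?B \<phi> E\<^sub>0" and adm: "admissible s ?B \<phi> E\<^sub>0 u E"
    and le: "\<And>v F. admissible s ?B \<phi> E\<^sub>0 v F \<Longrightarrow> ?en u E \<le> ?en v F"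
    using min unfolding minimizing_pair_def by blast
  obtain v F where "admissible s ?B \<phi> E\<^sub>0 v F" "?en v F < \<infinity>"
    using data unfolding external_data_def by blast
  then have "?en u E < \<infinity>" using le by (meson order_le_less_trans)
  then obtain m where m: "0 \<le> m" "?en u E = ennreal m"
    by (cases "?en u E") auto
  have [measurable]: "u \<in> borel_measurable borel"
    using cont by (rule borel_measurable_continuous_onI)
  have "bounded (u ` cball 0 1)"
    using cont by (intro compact_imp_bounded compact_continuous_image) (auto intro: continuous_on_subset)
  then obtain K where "\<forall>x\<in>cball 0 1. \<bar>u x\<bar> \<le> K"
    unfolding bounded_iff by auto
  then have K: "\<And>x. x \<in> ?B \<Longrightarrow> \<bar>u x\<bar> \<le> K" by simp
  have "K \<ge> 0" using K[of 0] by simp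
  have gu: "gagliardo s u (UNIV - (- ?B) \<times> (- ?B)) < \<infinity>"
    using gagliardo_le_energy[of s u ?B \<sigma> E] m by (metis ennreal_less_top infinity_ennreal_def order_le_less_trans)
  \<comment> \<open>A common bound \<open>K\<close> on the ball keeps \<open>v - u\<close> bounded.
    It passes to the pushes, which rearrange the values of \<open>u\<close> inside the ball, and to
    maxima and minima.\<close>
  have comp: "ennreal m \<le> ?en v F"
    if [measurable]: "v \<in> borel_measurable borel" and F: "F \<in> sets borel"
      and out: "\<And>x. x \<notin> ?B \<Longrightarrow> v x = u x" and bd: "\<And>x. x \<in> ?B \<Longrightarrow> \<bar>v x\<bar> \<le> K"
      and fin: "?en v F < \<infinity>" and FE: "F - ?B = E - ?B"
      and "\<And>x. x \<in> F \<Longrightarrow> v x \<ge> 0" "\<And>x. x \<notin> F \<Longrightarrow> v x \<le> 0" for v F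
  proof -
    have "\<bar>v x - u x\<bar> \<le> 2 * K" for x
    proof (cases "x \<in> ?B")
      case True
      then show ?thesis using K[of x] bd[of x] by linarith
    next
      case False
      then show ?thesis using out \<open>K \<ge> 0\<close> by simp
    qed
    moreover have "gagliardo s v (UNIV - (- ?B) \<times> (- ?B)) < \<infinity>"
      using gagliardo_le_energy[of s v ?B \<sigma> F] fin by (rule order_le_less_trans)
    ultimately have "admissible s ?B \<phi> E\<^sub>0 v F"
      using that by (intro admissible_competitor[OF adm _ _ F out _ gu _ FE]) auto
    then show ?thesis using le m(2) by metis
  qed
  show thesis
  proof (rule that[OF m(1)])
    fix t and e :: "real^2" and A B
    assume t: "\<bar>t\<bar> * (4 * norm e) \<le> 1/16" and AB: "A \<in> sets borel" "B \<in> sets borel"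
      "A \<subseteq> E - inv (push t e) -` E" "B \<subseteq> inv (push t e) -` E - E"
    have t': "\<bar>- t\<bar> * (4 * norm e) \<le> 1/16" using t by simp
    let ?S = "\<lambda>t. inv (push t e)"
    define v where "v = (\<lambda>t x. u (?S t x))"
    define F where "F = (\<lambda>t. ?S t -` E)"
    let ?c = "400 * (t * (4 * norm e))\<^sup>2"
    have S: "?S t \<in> borel_measurable borel" "?S (- t) \<in> borel_measurable borel"
      using continuous_push_inverse[OF t] continuous_push_inverse[OF t']
      by (auto intro!: borel_measurable_continuous_onI)
    have F[measurable]: "F t \<in> sets borel" "F (- t) \<in> sets borel"
      unfolding F_def using measurable_sets_borel[OF S(1)] measurable_sets_borel[OF S(2)] by auto
    have v[measurable]: "v t \<in> borel_measurable borel" "v (- t) \<in> borel_measurable borel"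
      unfolding v_def using S by (auto intro: measurable_compose)
    have out: "v t x = u x" "v (- t) x = u x" if "x \<notin> ?B" for x
      using push_inverse_outside[OF t that] push_inverse_outside[OF t' that] by (simp_all add: v_def)
    have bd: "\<bar>v t x\<bar> \<le> K" "\<bar>v (- t) x\<bar> \<le> K" if "x \<in> ?B" for x
      using push_inverse_mem_ball[OF t, of x] push_inverse_mem_ball[OF t', of x] that
      unfolding v_def by (blast intro: K)+
    have FE: "F t - ?B = E - ?B" "F (- t) - ?B = E - ?B"
      using push_inverse_outside[OF t] push_inverse_outside[OF t'] by (auto simp: F_def)
    have vs: "x \<in> F r \<Longrightarrow> v r x \<ge> 0" "x \<notin> F r \<Longrightarrow> v r x \<le> 0" for r x
      using sgn by (auto simp: F_def v_def)
    have sum: "?en (v t) (F t) + ?en (v (- t)) (F (- t)) \<le> ennreal (2 + ?c) * ennreal m"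
      using energy_second_variation[OF s \<sigma> t \<open>u \<in> _\<close> E] unfolding v_def F_def m(2) .
    also have "\<dots> < \<infinity>" by (simp add: ennreal_mult_less_top)
    finally have fin: "?en (v t) (F t) < \<infinity>" "?en (v (- t)) (F (- t)) < \<infinity>" by auto
    let ?p = "?en (\<lambda>x. max (u x) (v t x)) (E \<union> F t)"
    let ?q = "?en (\<lambda>x. min (u x) (v t x)) (E \<inter> F t)"
    let ?L = "pair_energy (2 + \<sigma>) ?B (\<lambda>x y. indicator A x * indicator B y)"
    have sub: "?p + ?q + ?L \<le> ennreal m + ?en (v t) (F t)"
      using energy_submodular[OF \<open>u \<in> _\<close> v(1) E F(1) _ AB(1,2), of ?B s \<sigma>] AB(3,4)
      unfolding m(2) F_def by simp
    also have "\<dots> < \<infinity>" using fin by simp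
    \<comment> \<open>Testing minimality against these two pairs requires their energies to be
      finite, which the submodular inequality itself supplies.\<close>
    finally have fin': "?p < \<infinity>" "?q < \<infinity>" by auto
    have "ennreal m \<le> ?en (v (- t)) (F (- t))"
      by (intro comp v F fin) (use out bd FE vs in auto)
    moreover have mm: "\<bar>max a b\<bar> \<le> K" "\<bar>min a b\<bar> \<le> K" if "\<bar>a\<bar> \<le> K" "\<bar>b\<bar> \<le> K" for a b
      using that by (auto simp: max_def min_def)
    moreover have "ennreal m \<le> ?p"
      by (intro comp fin') (use out bd K FE vs sgn mm in \<open>auto simp: le_max_iff_disj\<close>)
    moreover have "ennreal m \<le> ?q"
      by (intro comp fin') (use out bd K FE vs sgn mm in \<open>auto simp: min_le_iff_disj\<close>)
    ultimately show "?L \<le> ennreal (?c * m)"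
      by (intro ennreal_cancel_energies[OF m(1) _ sum _ _ _ sub]) auto
  qed
qed

subsection \<open>Translations of the cone\<close>

text \<open>On the product of the balls the kernel is at least \<open>1 / R powr p\<close>, and each
  ball has measure \<open>unit_ball_vol 2 * r\<^sup>2\<close>. Pairs with first point in
  \<open>\<Omega>\<close> always belong to the integration domain.\<close>

lemma pair_energy_balls_ge:
  fixes a b :: "real^2"
  assumes sub: "ball a r \<subseteq> \<Omega>" and disj: "ball a r \<inter> ball b r = {}"
    and R: "norm (a - b) + 2 * r \<le> R" and r: "r > 0" and p: "p \<ge> 0"
  shows "ennreal ((unit_ball_vol 2 * r\<^sup>2)\<^sup>2 / R powr p)
    \<le> pair_energy p \<Omega> (\<lambda>x y. indicator (ball a r) x * indicator (ball b r) y)"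
proof -
  let ?V = "ennreal (unit_ball_vol 2 * r\<^sup>2)"
  have V: "emeasure lborel (ball c r) = ?V" for c :: "real^2"
    using emeasure_ball[of r c] r by simp
  have Rp: "R > 0" using R r by (smt (verit) norm_ge_zero)
  have vp: "unit_ball_vol 2 * r\<^sup>2 \<ge> 0" by simp
  have "ennreal ((unit_ball_vol 2 * r\<^sup>2)\<^sup>2 / R powr p) = ennreal (1 / R powr p) * ?V * ?V"
    using vp by (simp add: ennreal_mult[symmetric] power2_eq_square)
  also have "\<dots> = (\<integral>\<^sup>+x. (ennreal (1 / R powr p) * ?V) * indicator (ball a r) x \<partial>lborel)"
    by (subst nn_integral_cmult_indicator) (simp_all add: V)
  also have "\<dots> = (\<integral>\<^sup>+x. \<integral>\<^sup>+y. (ennreal (1 / R powr p) * indicator (ball a r) x) * indicator (ball b r) y \<partial>lborel \<partial>lborel)"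
    by (subst nn_integral_cmult_indicator) (simp_all add: V mult_ac)
  also have "\<dots> \<le> pair_energy p \<Omega> (\<lambda>x y. indicator (ball a r) x * indicator (ball b r) y)"
    unfolding pair_energy_def
  proof (intro nn_integral_mono)
    fix x y
    show "(ennreal (1 / R powr p) * indicator (ball a r) x) * indicator (ball b r) y
      \<le> indicator (ball a r) x * indicator (ball b r) y * ennreal (1 / norm (x - y) powr p) *
        indicator (UNIV - (- \<Omega>) \<times> (- \<Omega>)) (x, y)"
    proof (cases "x \<in> ball a r \<and> y \<in> ball b r")
      case True
      \<comment> \<open>Distinctness matters: on the diagonal the kernel is 0 by division by
        zero.\<close>
      then have "x \<in> \<Omega>" "x \<noteq> y" using sub disj by auto
      moreover have "norm (x - y) \<le> R"
      proof -
        have "norm (x - y) \<le> norm (x - a) + norm (a - b) + norm (b - y)"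
          by (smt (verit) norm_triangle_ineq diff_add_cancel add_diff_eq)
        then show ?thesis using True R by (simp add: dist_norm norm_minus_commute)
      qed
      ultimately have "1 / R powr p \<le> 1 / norm (x - y) powr p"
        using p Rp by (intro divide_left_mono powr_mono2) auto
      then show ?thesis using True \<open>x \<in> \<Omega>\<close> by (simp add: ennreal_leI)
    next
      case False
      then show ?thesis by auto
    qed
  qed
  finally show ?thesis .
qed

text \<open>Seen at scale \<open>t\<close>, the inverse push is almost the translation by
  \<open>- e\<close>, since the preimage has norm at most \<open>t * N\<close> and
  \<open>bump\<close> differs there from 1 by at most \<open>2 * (t * N)\<^sup>2\<close>.\<close>

lemma push_inverse_near_translation:
  fixes e :: "real^2"
  assumes t: "\<bar>t\<bar> * (4 * norm e) \<le> 1/16" and tp: "t > 0" and \<epsilon>: "\<epsilon> > 0"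
    and N: "norm x + norm e + \<epsilon> \<le> N" and small: "2 * (t * N)\<^sup>2 * norm e \<le> \<epsilon>"
    and z: "z \<in> ball (t *\<^sub>R x) (t * \<epsilon>)"
  obtains w where "inv (push t e) z = t *\<^sub>R w" "w \<in> ball (x - e) (2 * \<epsilon>)"
proof
  define y where "y = inv (push t e) z"
  have "push t e y = z" using push_inverse(2)[OF t] by (simp add: y_def)
  then have y: "y = z - (t * bump y) *\<^sub>R e" by (simp add: push_def algebra_simps)
  let ?w = "(1 / t) *\<^sub>R y"
  show "inv (push t e) z = t *\<^sub>R ?w" using tp by (simp add: y_def)
  have zx: "norm (z - t *\<^sub>R x) < t * \<epsilon>" using z by (simp add: dist_norm norm_minus_commute)
  have "norm y \<le> norm (z - t *\<^sub>R x) + norm (t *\<^sub>R x) + norm ((t * bump y) *\<^sub>R e)"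
    by (subst y) (smt (verit) norm_triangle_ineq4 norm_triangle_ineq diff_add_cancel)
  also have "norm ((t * bump y) *\<^sub>R e) \<le> t * norm e"
    using tp bump_bounds[of y] by (simp add: abs_mult mult_right_le_one_le mult_left_mono mult_right_mono)
  finally have "norm y \<le> t * \<epsilon> + t * norm x + t * norm e"
    using zx tp by simp
  also have "\<dots> \<le> t * N" using mult_left_mono[OF N, of t] tp by (simp add: algebra_simps)
  finally have "(norm y)\<^sup>2 \<le> (t * N)\<^sup>2" by (simp add: power_mono)
  then have "1 - bump y \<le> 2 * (t * N)\<^sup>2" using one_minus_bump_le[of y] by linarith
  then have be: "(1 - bump y) * norm e \<le> \<epsilon>"
    using small by (smt (verit) mult_right_mono norm_ge_zero)
  \<comment> \<open>Two errors of size \<open>\<epsilon>\<close>: the rescaled offset of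
    \<open>z\<close> from \<open>t *\<^sub>R x\<close>, and the deficit of
    \<open>bump\<close>.\<close>
  have "?w - (x - e) = (1 / t) *\<^sub>R (z - t *\<^sub>R x) + (1 - bump y) *\<^sub>R e"
    using tp by (subst y) (simp add: algebra_simps)
  then have "norm (?w - (x - e)) \<le> norm ((1 / t) *\<^sub>R (z - t *\<^sub>R x)) + norm ((1 - bump y) *\<^sub>R e)"
    by (metis norm_triangle_ineq)
  also have "norm ((1 - bump y) *\<^sub>R e) \<le> \<epsilon>" using be bump_bounds[of y] by simp
  also have "norm ((1 / t) *\<^sub>R (z - t *\<^sub>R x)) < \<epsilon>"
    unfolding norm_scaleR using zx tp by (simp add: pos_divide_less_eq mult.commute)
  finally show "?w \<in> ball (x - e) (2 * \<epsilon>)" by (simp add: dist_norm norm_minus_commute)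
qed

lemma cone_translation_dichotomy:
  fixes E :: "(real^2) set"
  assumes "closed E" and reg: "E \<subseteq> closure (interior E)"
    and cone: "\<And>t x. t > 0 \<Longrightarrow> x \<in> E \<Longrightarrow> t *\<^sub>R x \<in> E"
    and \<sigma>: "0 < \<sigma>" "\<sigma> < 1"
    and bound: "\<And>t A B. \<lbrakk>\<bar>t\<bar> * (4 * norm e) \<le> 1/16; A \<in> sets borel; B \<in> sets borel;
        A \<subseteq> E - inv (push t e) -` E; B \<subseteq> inv (push t e) -` E - E\<rbrakk>
      \<Longrightarrow> pair_energy (2 + \<sigma>) (ball 0 1) (\<lambda>x y. indicator A x * indicator B y)
        \<le> ennreal (400 * (t * (4 * norm e))\<^sup>2 * m)" and m: "m \<ge> 0"
  shows "(\<forall>x\<in>E. x + e \<in> E) \<or> (\<forall>x\<in>E. x - e \<in> E)"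
proof (rule ccontr)
  assume "\<not> ?thesis"
  then obtain x1 y1 where 1: "x1 \<in> E" "x1 - e \<notin> E" "y1 \<in> E" "y1 + e \<notin> E" by blast
  \<comment> \<open>Leaving the closed set \<open>E\<close> under a translation is an open
    condition, so by density of the interior it also occurs at an interior point. This provides
    whole balls instead of single points.\<close>
  have perturb: "\<exists>x\<in>interior E. x + d \<notin> E" if "z \<in> E" "z + d \<notin> E" for z d
  proof -
    have "open ((\<lambda>x. x + d) -` (- E))"
      using \<open>closed E\<close> by (intro open_vimage continuous_intros) auto
    moreover have "(\<lambda>x. x + d) -` (- E) = {x. x + d \<notin> E}" by auto
    ultimately have "open {x. x + d \<notin> E}" by simp
    moreover have "z \<in> closure (interior E)" using reg that by blast
    ultimately show ?thesis
      using that open_Int_closure_eq_empty[of "{x. x + d \<notin> E}" "interior E"] by auto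
  qed
  obtain x where x: "x \<in> interior E" "x - e \<in> - E" using perturb[of x1 "- e"] 1 by auto
  obtain y' where y': "y' \<in> interior E" "y' + e \<in> - E" using perturb[of y1 e] 1 by auto
  define y where "y = y' + e"
  have y: "y \<in> - E" "y - e \<in> interior E" using y' by (simp_all add: y_def)
  have oE: "open (- E)" using \<open>closed E\<close> by (rule open_Compl)
  obtain \<epsilon>1 \<epsilon>2 \<epsilon>3 \<epsilon>4 where eps: "\<epsilon>1 > 0" "ball x \<epsilon>1 \<subseteq> interior E" "\<epsilon>2 > 0" "ball (x - e) \<epsilon>2 \<subseteq> - E"
      "\<epsilon>3 > 0" "ball y \<epsilon>3 \<subseteq> - E" "\<epsilon>4 > 0" "ball (y - e) \<epsilon>4 \<subseteq> interior E"
    using x y oE open_interior[of E] by (metis open_contains_ball)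
  \<comment> \<open>Halving leaves room for the doubled radius in
    \<open>push_inverse_near_translation\<close>.\<close>
  define \<epsilon> where "\<epsilon> = Min {\<epsilon>1, \<epsilon>2, \<epsilon>3, \<epsilon>4} / 2"
  have \<epsilon>: "\<epsilon> > 0" "2 * \<epsilon> \<le> \<epsilon>1" "2 * \<epsilon> \<le> \<epsilon>2" "2 * \<epsilon> \<le> \<epsilon>3" "2 * \<epsilon> \<le> \<epsilon>4"
    using eps by (auto simp: \<epsilon>_def)
  have b: "ball x (2 * \<epsilon>) \<subseteq> E" "ball (x - e) (2 * \<epsilon>) \<subseteq> - E" "ball y (2 * \<epsilon>) \<subseteq> - E" "ball (y - e) (2 * \<epsilon>) \<subseteq> E"
    using eps interior_subset[of E] subset_ball[OF \<epsilon>(2)] subset_ball[OF \<epsilon>(3)]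
      subset_ball[OF \<epsilon>(4)] subset_ball[OF \<epsilon>(5)] by blast+
  have coneC: "t *\<^sub>R z \<in> E \<longleftrightarrow> z \<in> E" if "t > 0" for t z
    using cone[OF that, of z] cone[of "1 / t" "t *\<^sub>R z"] that by auto
  define N where "N = norm x + norm y + norm e + \<epsilon> + 1"
  define R where "R = norm (x - y) + 2 * \<epsilon>"
  have R: "R > 0" using \<epsilon> by (simp add: R_def add_nonneg_pos)
  have Np: "N > 0" using \<epsilon> by (simp add: N_def add_nonneg_pos)
  define c where "c = (unit_ball_vol 2 * \<epsilon>\<^sup>2)\<^sup>2 / R powr (2 + \<sigma>)"
  have c: "c > 0"
    unfolding c_def using \<epsilon> R unit_ball_vol_pos[of 2]
    by (intro divide_pos_pos zero_less_power mult_pos_pos) auto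
  define k where "k = 400 * (4 * norm e)\<^sup>2 * m"
  \<comment> \<open>Two balls of radius \<open>t * \<epsilon>\<close> at distance of order
    \<open>t\<close> interact at least like \<open>c * t powr (2 - \<sigma>)\<close>, while
    \<open>bound\<close> allows at most \<open>k * t\<^sup>2\<close>. Letting \<open>t\<close> tend
    to 0 then contradicts \<open>c > 0\<close>.\<close>
  have ineq: "c \<le> k * t powr \<sigma>"
    if t: "t > 0" "t * (4 * norm e) \<le> 1/16" "t * N \<le> 1" "2 * (t * N)\<^sup>2 * norm e \<le> \<epsilon>" for t
  proof -
    have t': "\<bar>t\<bar> * (4 * norm e) \<le> 1/16" using t by simp
    let ?A = "ball (t *\<^sub>R x) (t * \<epsilon>)" and ?B = "ball (t *\<^sub>R y) (t * \<epsilon>)"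
    have scale: "\<exists>w\<in>ball q (2 * \<epsilon>). z = t *\<^sub>R w" if "z \<in> ball (t *\<^sub>R q) (t * \<epsilon>)" for z q :: "real^2"
    proof
      show "z = t *\<^sub>R ((1 / t) *\<^sub>R z)" using t(1) by simp
      have "norm (t *\<^sub>R (q - (1 / t) *\<^sub>R z)) < t * \<epsilon>"
        using that t by (simp add: dist_norm scaleR_diff_right)
      then have "norm (q - (1 / t) *\<^sub>R z) < \<epsilon>" using t by simp
      then show "(1 / t) *\<^sub>R z \<in> ball q (2 * \<epsilon>)" using \<epsilon> by (simp add: dist_norm)
    qed
    have A: "?A \<subseteq> E - inv (push t e) -` E"
    proof
      fix z assume z: "z \<in> ?A"
      have "z \<in> E" using scale[OF z] b(1) coneC[OF t(1)] by blast
      moreover have "norm x + norm e + \<epsilon> \<le> N" by (simp add: N_def)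
      from push_inverse_near_translation[OF t' t(1) \<epsilon>(1) this t(4) z]
      have "inv (push t e) z \<notin> E" using b(2) coneC[OF t(1)] by (metis ComplD subsetD)
      ultimately show "z \<in> E - inv (push t e) -` E" by simp
    qed
    have B: "?B \<subseteq> inv (push t e) -` E - E"
    proof
      fix z assume z: "z \<in> ?B"
      have "z \<notin> E" using scale[OF z] b(3) coneC[OF t(1)] by blast
      moreover have "norm y + norm e + \<epsilon> \<le> N" by (simp add: N_def)
      from push_inverse_near_translation[OF t' t(1) \<epsilon>(1) this t(4) z]
      have "inv (push t e) z \<in> E" using b(4) coneC[OF t(1)] by (metis subsetD)
      ultimately show "z \<in> inv (push t e) -` E - E" by simp
    qed
    have "?A \<subseteq> ball 0 1"
    proof
      fix z assume "z \<in> ?A"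
      then have "norm (z - t *\<^sub>R x) < t * \<epsilon>" by (simp add: dist_norm norm_minus_commute)
      then have "norm z < t * \<epsilon> + t * norm x"
        using norm_triangle_sub[of z "t *\<^sub>R x"] t(1) by simp
      also have "\<dots> = t * (\<epsilon> + norm x)" by (simp add: algebra_simps)
      also have "\<dots> \<le> t * N" using t(1) by (intro mult_left_mono) (auto simp: N_def)
      finally show "z \<in> ball 0 1" using t(3) by simp
    qed
    moreover have "?A \<inter> ?B = {}" using A B by blast
    moreover have "norm (t *\<^sub>R x - t *\<^sub>R y) = t * norm (x - y)"
      unfolding scaleR_diff_right[symmetric] norm_scaleR using t(1) by simp
    then have "norm (t *\<^sub>R x - t *\<^sub>R y) + 2 * (t * \<epsilon>) \<le> t * R"
      by (simp add: R_def distrib_left)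
    ultimately have "ennreal ((unit_ball_vol 2 * (t * \<epsilon>)\<^sup>2)\<^sup>2 / (t * R) powr (2 + \<sigma>))
       \<le> pair_energy (2 + \<sigma>) (ball 0 1) (\<lambda>x y. indicator ?A x * indicator ?B y)"
      using t(1) \<epsilon>(1) \<sigma> by (intro pair_energy_balls_ge) auto
    also have "\<dots> \<le> ennreal (400 * (t * (4 * norm e))\<^sup>2 * m)"
      by (rule bound[OF t' _ _ A B]) simp_all
    finally have "(unit_ball_vol 2 * (t * \<epsilon>)\<^sup>2)\<^sup>2 / (t * R) powr (2 + \<sigma>) \<le> 400 * (t * (4 * norm e))\<^sup>2 * m"
      using m by (subst (asm) ennreal_le_iff) auto
    also have "\<dots> = k * t\<^sup>2" by (simp add: k_def power_mult_distrib)
    also have "(unit_ball_vol 2 * (t * \<epsilon>)\<^sup>2)\<^sup>2 / (t * R) powr (2 + \<sigma>) = c * (t\<^sup>2 * (t\<^sup>2 / t powr (2 + \<sigma>)))"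
      using t(1) R by (simp add: c_def powr_mult power2_eq_square mult_ac)
    also have "t\<^sup>2 / t powr (2 + \<sigma>) = 1 / t powr \<sigma>"
      using t(1) by (simp add: powr_add)
    finally show ?thesis using t(1) by (simp add: field_simps)
  qed
  have "\<forall>\<^sub>F t in at_right 0. t > (0::real)" by (simp add: eventually_at_right_less)
  moreover have ev: "\<forall>\<^sub>F t in at_right 0. f t \<le> a" if "isCont f (0::real)" "f 0 < a" for f and a :: real
  proof -
    have "(f \<longlongrightarrow> f 0) (at_right 0)" using that(1) by (simp add: isCont_def filterlim_at_split)
    from order_tendstoD(2)[OF this that(2)] show ?thesis by (rule eventually_mono) simp
  qed
  have "\<forall>\<^sub>F t in at_right 0. t * (4 * norm e) \<le> 1/16" by (rule ev) auto
  moreover have "\<forall>\<^sub>F t in at_right 0. t * N \<le> 1" by (rule ev) auto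
  moreover have "\<forall>\<^sub>F t in at_right 0. 2 * (t * N)\<^sup>2 * norm e \<le> \<epsilon>" by (rule ev) (use \<epsilon> in auto)
  ultimately have "\<forall>\<^sub>F t in at_right 0. c \<le> k * t powr \<sigma>"
    by eventually_elim (rule ineq)
  moreover have "((\<lambda>t. k * t powr \<sigma>) \<longlongrightarrow> k * 0) (at_right 0)"
    using \<sigma> by (intro tendsto_mult tendsto_const tendsto_zero_powrI[of _ _ _ \<sigma>])
      (auto intro: tendsto_ident_at eventually_at_right_less eventually_mono[OF eventually_at_right_less])
  ultimately have "c \<le> k * 0"
    by (intro tendsto_lowerbound[of _ "k * 0" "at_right 0" c]) auto
  then show False using c by simp
qed

section \<open>From translations to a halfplane\<close>

text \<open>A point \<open>z\<close> outside \<open>E\<close> is separated from the closed convex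
  cone \<open>C\<close> of translations preserving \<open>E\<close>. As \<open>C\<close> and its
  negative cover the plane, \<open>C\<close> contains the whole halfplane of the separating
  functional, and a point of \<open>E\<close> beyond that halfplane would force \<open>z\<close>
  into \<open>E\<close>.\<close>

lemma halfplane_of_translation_dichotomy:
  fixes E :: "(real^2) set"
  assumes "closed E" and zero: "0 \<in> E" and ne: "E \<noteq> UNIV"
    and cone: "\<And>t x. t > 0 \<Longrightarrow> x \<in> E \<Longrightarrow> t *\<^sub>R x \<in> E"
    and dich: "\<And>e. (\<forall>x\<in>E. x + e \<in> E) \<or> (\<forall>x\<in>E. x - e \<in> E)"
  shows "halfplane E"
proof -
  define C where "C = {e. \<forall>x\<in>E. x + e \<in> E}"
  have CE: "C \<subseteq> E" using zero by (force simp: C_def)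
  have C0: "0 \<in> C" by (simp add: C_def)
  have Cadd: "a + b \<in> C" if "a \<in> C" "b \<in> C" for a b
    using that by (simp add: C_def add.assoc[symmetric])
  have Cscale: "t *\<^sub>R a \<in> C" if "a \<in> C" "t > 0" for a t
  proof -
    have "x + t *\<^sub>R a \<in> E" if "x \<in> E" for x
    proof -
      have "(1 / t) *\<^sub>R x + a \<in> E" using cone[of "1 / t" x] that \<open>t > 0\<close> \<open>a \<in> C\<close> by (simp add: C_def)
      from cone[OF \<open>t > 0\<close> this] show ?thesis using \<open>t > 0\<close> by (simp add: algebra_simps)
    qed
    then show ?thesis by (simp add: C_def)
  qed
  have Cdich: "e \<in> C \<or> - e \<in> C" for e using dich[of e] by (simp add: C_def)
  have "convex C"
    unfolding convex_alt using Cadd Cscale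
    by (metis C0 add_0_left add_0_right diff_gt_0_iff_gt diff_self less_eq_real_def scaleR_one scaleR_zero_left diff_zero)
  have "C = (\<Inter>x\<in>E. (\<lambda>e. x + e) -` E)" by (auto simp: C_def)
  then have "closed C" using \<open>closed E\<close> by (auto intro!: closed_vimage continuous_intros)
  obtain z where z: "z \<notin> E" using ne by blast
  then obtain a b where ab: "a \<bullet> z < b" "\<forall>x\<in>C. a \<bullet> x > b"
    using separating_hyperplane_closed_point[OF \<open>convex C\<close> \<open>closed C\<close>, of z] CE by blast
  have b: "b < 0" using ab(2) C0 by force
  have Cpos: "a \<bullet> x \<ge> 0" if "x \<in> C" for x
  proof (rule ccontr)
    assume neg: "\<not> ?thesis"
    \<comment> \<open>This multiple lies exactly on the separating line, where the strict inequality
      fails.\<close>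
    then have "(b / (a \<bullet> x)) *\<^sub>R x \<in> C" using b that by (intro Cscale) (auto simp: divide_neg_neg)
    then show False using ab(2) neg by force
  qed
  have a: "a \<noteq> 0" using ab b by auto
  have posC: "x \<in> C" if "a \<bullet> x > 0" for x
    using Cdich[of x] Cpos[of "- x"] that by auto
  have nnC: "x \<in> C" if "a \<bullet> x \<ge> 0" for x
  proof -
    have "(\<lambda>n. x + (1 / Suc n) *\<^sub>R a) \<longlonglongrightarrow> x + 0 *\<^sub>R a"
      by (intro tendsto_intros LIMSEQ_Suc lim_1_over_n)
    moreover have "x + (1 / Suc n) *\<^sub>R a \<in> C" for n
      using that a by (intro posC) (simp add: inner_add_right add_nonneg_pos)
    ultimately show ?thesis using \<open>closed C\<close> closed_sequentially[of C "\<lambda>n. x + (1 / Suc n) *\<^sub>R a"] by simp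
  qed
  have "a \<bullet> x \<ge> 0" if "x \<in> E" for x
  proof (rule ccontr)
    assume neg: "\<not> ?thesis"
    \<comment> \<open>Large enough for the functional to be positive at
      \<open>z - t *\<^sub>R x\<close>, so that this vector is an allowed translation taking
      \<open>t *\<^sub>R x\<close> to \<open>z\<close>.\<close>
    define t where "t = (\<bar>a \<bullet> z\<bar> + 1) / (- (a \<bullet> x))"
    have t: "t > 0" unfolding t_def using neg by (intro divide_pos_pos) auto
    have "a \<bullet> (z - t *\<^sub>R x) = a \<bullet> z + (\<bar>a \<bullet> z\<bar> + 1)"
      using neg by (simp add: t_def inner_diff_right inner_add_right)
    then have "z - t *\<^sub>R x \<in> C" by (intro nnC) simp
    then have "t *\<^sub>R x + (z - t *\<^sub>R x) \<in> E" using cone[OF t that] unfolding C_def by blast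
    then show False using z by simp
  qed
  then have "E = {x. a \<bullet> x \<ge> 0}" using nnC CE by blast
  then show ?thesis using a by (auto simp: halfplane_def)
qed

subsection \<open>Sectors and the unit ball\<close>

text \<open>Near a boundary point \<open>p\<close>, along the inner normal \<open>- p\<close>, the
  disc lies above a lower arc of the circle. Truncating the norm at 1/2 makes the graph function
  globally Lipschitz without changing it within distance 1/2 of \<open>p\<close>.\<close>

lemma bounded_lipschitz_domain_unit_ball:
  "bounded_lipschitz_domain (ball (0::real^2) 1)"
proof -
  define h where "h = (\<lambda>y::real^2. - sqrt (1 - (min (norm y) (1/2))\<^sup>2))"
  have h: "1-lipschitz_on UNIV h"
  proof (rule lipschitz_onI)
    fix x y :: "real^2"
    define a b where "a = min (norm x) (1/2)" and "b = min (norm y) (1/2)"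
    have ab: "0 \<le> a" "a \<le> 1/2" "0 \<le> b" "b \<le> 1/2" by (auto simp: a_def b_def)
    have sq: "a\<^sup>2 \<le> 1/4" "b\<^sup>2 \<le> 1/4"
      using power_mono[of a "1/2" 2] power_mono[of b "1/2" 2] ab by (auto simp: power2_eq_square)
    define p q where "p = sqrt (1 - a\<^sup>2)" and "q = sqrt (1 - b\<^sup>2)"
    have "1/2 \<le> sqrt (1 - x)" if "x \<le> 1/4" for x :: real
      using that by (intro real_le_rsqrt) (simp add: power_divide)
    then have pq: "p \<ge> 1/2" "q \<ge> 1/2"
      unfolding p_def q_def using sq by blast+
    have "p\<^sup>2 = 1 - a\<^sup>2" "q\<^sup>2 = 1 - b\<^sup>2" unfolding p_def q_def using sq by auto
    then have "(p - q) * (p + q) = (b - a) * (b + a)" by (simp add: power2_eq_square algebra_simps)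
    then have "\<bar>(p - q) * (p + q)\<bar> = \<bar>(b - a) * (b + a)\<bar>" by simp
    then have "\<bar>p - q\<bar> * (p + q) = \<bar>b - a\<bar> * (b + a)"
      using pq ab by (simp add: abs_mult)
    \<comment> \<open>Because \<open>a + b \<le> 1 \<le> p + q\<close>.\<close>
    also have "\<dots> \<le> \<bar>b - a\<bar> * (p + q)" using ab pq by (intro mult_left_mono) auto
    finally have "\<bar>p - q\<bar> \<le> \<bar>b - a\<bar>" using pq by simp
    also have "\<bar>b - a\<bar> \<le> \<bar>norm x - norm y\<bar>" unfolding a_def b_def by linarith
    also have "\<dots> \<le> norm (x - y)" by (rule norm_triangle_ineq3)
    finally show "dist (h x) (h y) \<le> 1 * dist x y"
      by (simp add: h_def dist_norm p_def q_def a_def b_def)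
  qed simp
  have "\<exists>r e L g. r > 0 \<and> norm e = 1 \<and> L-lipschitz_on {y. y \<bullet> e = 0} g \<and>
        (\<forall>x \<in> ball p r. x \<in> ball 0 1 \<longleftrightarrow> g (x - (x \<bullet> e) *\<^sub>R e) < x \<bullet> e)"
    if "p \<in> frontier (ball (0::real^2) 1)" for p
  proof (intro exI conjI ballI)
    have p: "norm p = 1" using that by (simp add: frontier_ball)
    show "(1/2::real) > 0" by simp
    show "norm (- p) = 1" using p by simp
    show "1-lipschitz_on {y. y \<bullet> - p = 0} h" using h by (rule lipschitz_on_subset) simp
    fix x assume x: "x \<in> ball p (1/2)"
    define c where "c = x \<bullet> p"
    define y where "y = x - c *\<^sub>R p"
    have pp: "p \<bullet> p = 1" using p by (simp add: dot_square_norm)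
    have yp: "y \<bullet> p = 0" by (simp add: y_def c_def inner_diff_left pp)
    have nx: "(norm x)\<^sup>2 = (norm y)\<^sup>2 + c\<^sup>2"
    proof -
      have "x = y + c *\<^sub>R p" by (simp add: y_def)
      then show ?thesis
        unfolding power2_norm_eq_inner
        using yp pp by (simp add: inner_add_left inner_add_right inner_commute power2_eq_square)
    qed
    have "(norm (x - p))\<^sup>2 = (norm y)\<^sup>2 + (c - 1)\<^sup>2"
    proof -
      have "x - p = y + (c - 1) *\<^sub>R p" by (simp add: y_def algebra_simps)
      then show ?thesis
        unfolding power2_norm_eq_inner
        using yp pp by (simp add: inner_add_left inner_add_right inner_commute power2_eq_square)
    qed
    moreover have "norm (x - p) < 1/2" using x by (simp add: dist_norm norm_minus_commute)
    then have "(norm (x - p))\<^sup>2 < (1/2)\<^sup>2" by (intro power_strict_mono) auto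
    ultimately have "(norm y)\<^sup>2 < (1/2)\<^sup>2" "(c - 1)\<^sup>2 < (1/2)\<^sup>2"
      using zero_le_power2[of "c - 1"] zero_le_power2[of "norm y"] by linarith+
    then have ny: "norm y < 1/2" and "\<bar>c - 1\<bar> < 1/2"
      using power2_less_imp_less[of "norm y" "1/2"] power2_less_imp_less[of "\<bar>c - 1\<bar>" "1/2"] by auto
    then have c: "c > 0" by linarith
    have "x \<in> ball 0 1 \<longleftrightarrow> (norm x)\<^sup>2 < 1" by (simp add: abs_square_less_1)
    also have "\<dots> \<longleftrightarrow> c\<^sup>2 < 1 - (norm y)\<^sup>2" using nx by auto
    also have "\<dots> \<longleftrightarrow> c < sqrt (1 - (norm y)\<^sup>2)"
      using c by (metis less_imp_le real_less_rsqrt real_sqrt_less_iff real_sqrt_unique)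
    also have "\<dots> \<longleftrightarrow> h y < - c" using ny by (simp add: h_def min_def)
    finally show "x \<in> ball 0 1 \<longleftrightarrow> h (x - (x \<bullet> - p) *\<^sub>R - p) < x \<bullet> - p"
      by (simp add: y_def c_def)
  qed
  then show ?thesis unfolding bounded_lipschitz_domain_def by auto
qed

section \<open>Regularity of sectors\<close>

lemma vector_2_inner: "vector [a, b] \<bullet> (x::real^2) = a * x$1 + b * x$2"
  by (simp add: inner_vec_def sum_2)

text \<open>With opening less than \<open>pi\<close> a sector is an intersection of two halfplanes,
  which makes its closedness and interior accessible.\<close>

lemma narrow_sector_eq:
  assumes ab: "a < b" "b < a + pi"
  shows "{vector [r * cos t, r * sin t] :: real^2 | r t. 0 \<le> r \<and> t \<in> {a..b}}
    = {x. vector [- sin a, cos a] \<bullet> x \<ge> 0 \<and> vector [sin b, - cos b] \<bullet> x \<ge> 0}" (is "?S = ?H")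
proof
  have i: "vector [- sin a, cos a] \<bullet> (vector [r * cos t, r * sin t] :: real^2) = r * sin (t - a)"
    "vector [sin b, - cos b] \<bullet> (vector [r * cos t, r * sin t] :: real^2) = r * sin (b - t)" for r t
    by (simp_all add: vector_2_inner sin_diff algebra_simps)
  show "?S \<subseteq> ?H"
    using ab by (auto simp: i intro!: mult_nonneg_nonneg sin_ge_zero)
  show "?H \<subseteq> ?S"
  proof
    fix x :: "real^2" assume x: "x \<in> ?H"
    define r where "r = norm x"
    \<comment> \<open>\<open>X\<close> and \<open>Y\<close> are the coordinates in the frame rotated
      by \<open>a\<close>, so that \<open>\<theta>\<close> below is the angle measured from the
      first side.\<close>
    define X where "X = x$1 * cos a + x$2 * sin a"
    define Y where "Y = x$2 * cos a - x$1 * sin a"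
    have "(sin a)\<^sup>2 + (cos a)\<^sup>2 = 1" by simp
    then have "X\<^sup>2 + Y\<^sup>2 = (x$1)\<^sup>2 + (x$2)\<^sup>2"
      unfolding X_def Y_def by algebra
    also have "\<dots> = r\<^sup>2"
      unfolding r_def power2_norm_eq_inner by (simp add: inner_vec_def sum_2 power2_eq_square)
    finally have XY: "X\<^sup>2 + Y\<^sup>2 = r\<^sup>2" .
    show "x \<in> ?S"
    proof (cases "r = 0")
      case True
      then have "x = vector [0 * cos a, 0 * sin a]" by (simp add: r_def vec_eq_iff forall_2)
      then show ?thesis using ab by fastforce
    next
      case False
      then have r: "r > 0" by (simp add: r_def)
      have "(X / r)\<^sup>2 + (Y / r)\<^sup>2 = 1" using XY r by (simp add: power_divide add_divide_distrib[symmetric])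
      then obtain \<theta> where \<theta>: "0 \<le> \<theta>" "\<theta> < 2 * pi" "X / r = cos \<theta>" "Y / r = sin \<theta>"
        using sincos_total_2pi[of "X / r" "Y / r"] by blast
      have X: "X = r * cos \<theta>" and Y: "Y = r * sin \<theta>" using \<theta> r by (auto simp: field_simps)
      have "x$1 = X * cos a - Y * sin a" "x$2 = X * sin a + Y * cos a"
        unfolding X_def Y_def using sin_cos_squared_add[of a] by algebra+
      then have xx: "x = vector [r * cos (a + \<theta>), r * sin (a + \<theta>)]"
        unfolding X Y by (simp add: vec_eq_iff forall_2 cos_add sin_add algebra_simps)
      have "r * sin \<theta> \<ge> 0" "r * sin (b - a - \<theta>) \<ge> 0"
        using x unfolding xx by (simp_all add: i diff_diff_eq)
      then have s: "sin \<theta> \<ge> 0" "sin (b - a - \<theta>) \<ge> 0" using r by (simp_all add: zero_le_mult_iff)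
      have "\<theta> \<le> pi"
      proof (rule ccontr)
        assume "\<not> ?thesis"
        then show False using sin_lt_zero[of \<theta>] \<theta> s by simp
      qed
      have "\<theta> \<le> b - a"
      proof (rule ccontr)
        assume "\<not> ?thesis"
        then have "sin (\<theta> - (b - a)) > 0" using \<open>\<theta> \<le> pi\<close> ab by (intro sin_gt_zero) auto
        then show False using s(2) sin_minus[of "\<theta> - (b - a)"] by simp
      qed
      then have "a + \<theta> \<in> {a..b}" using \<theta> by simp
      then show ?thesis using xx r less_imp_le by blast
    qed
  qed
qed

lemma narrow_sector_regular:
  assumes ab: "a < b" "b < a + pi"
    and S: "S = {vector [r * cos t, r * sin t] :: real^2 | r t. 0 \<le> r \<and> t \<in> {a..b}}"
  shows "closed S" "S \<subseteq> closure (interior S)"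
proof -
  define n1 n2 :: "real^2" where "n1 = vector [- sin a, cos a]" and "n2 = vector [sin b, - cos b]"
  have SH: "S = {x. n1 \<bullet> x \<ge> 0} \<inter> {x. n2 \<bullet> x \<ge> 0}"
    unfolding S narrow_sector_eq[OF ab] n1_def n2_def by auto
  show "closed S"
    unfolding SH by (intro closed_Int closed_halfspace_ge)
  let ?U = "{x. n1 \<bullet> x > 0} \<inter> {x. n2 \<bullet> x > 0}"
  have "open ?U" by (intro open_Int open_halfspace_gt)
  moreover have "?U \<subseteq> S" unfolding SH by auto
  ultimately have U: "?U \<subseteq> interior S" by (simp add: interior_maximal)
  \<comment> \<open>The bisector makes the angle \<open>(b - a) / 2\<close> with each side; adding
    any positive multiple of it moves a point of the sector into the interior.\<close>
  define w :: "real^2" where "w = vector [cos ((a + b) / 2), sin ((a + b) / 2)]"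
  have "n1 \<bullet> w = sin ((a + b) / 2 - a)" "n2 \<bullet> w = sin (b - (a + b) / 2)"
    by (simp_all only: n1_def n2_def w_def vector_2_inner sin_diff vector_2) (simp_all add: algebra_simps)
  moreover have "sin ((a + b) / 2 - a) > 0" "sin (b - (a + b) / 2) > 0"
    using ab pi_gt_zero by (intro sin_gt_zero; simp add: field_simps)+
  ultimately have w: "n1 \<bullet> w > 0" "n2 \<bullet> w > 0" by simp_all
  show "S \<subseteq> closure (interior S)"
  proof
    fix x assume "x \<in> S"
    have "(\<lambda>n. x + (1 / Suc n) *\<^sub>R w) \<longlonglongrightarrow> x + 0 *\<^sub>R w"
      by (intro tendsto_intros LIMSEQ_Suc lim_1_over_n)
    moreover have "x + (1 / Suc n) *\<^sub>R w \<in> interior S" for n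
    proof (rule subsetD[OF U])
      show "x + (1 / Suc n) *\<^sub>R w \<in> ?U"
        using \<open>x \<in> S\<close> w unfolding SH by (simp add: inner_add_right add_nonneg_pos)
    qed
    ultimately show "x \<in> closure (interior S)"
      unfolding closure_sequential
      by (intro exI[of _ "\<lambda>n. x + (1 / Suc n) *\<^sub>R w"]) simp
  qed
qed

lemma closed_sector_regular:
  assumes "closed_sector S"
  shows "closed S" "S \<subseteq> closure (interior S)" "0 \<in> S" "\<And>t x. t > 0 \<Longrightarrow> x \<in> S \<Longrightarrow> t *\<^sub>R x \<in> S"
proof -
  obtain a b where ab: "a < b" "b < a + 2 * pi"
    and S: "S = {vector [r * cos t, r * sin t] | r t. 0 \<le> r \<and> t \<in> {a..b}}"
    using assms unfolding closed_sector_def by blast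
  let ?T = "\<lambda>a b. {vector [r * cos t, r * sin t] :: real^2 | r t. 0 \<le> r \<and> t \<in> {a..b}}"
  \<comment> \<open>An opening of \<open>pi\<close> or more is handled by cutting along the bisector
    into two narrow sectors.\<close>
  define c where "c = (a + b) / 2"
  have c: "a < c" "c < a + pi" "c < b" "b < c + pi" using ab by (auto simp: c_def field_simps)
  have "{a..b} = {a..c} \<union> {c..b}" using c by auto
  then have split: "S = ?T a c \<union> ?T c b" unfolding S by blast
  note 1 = narrow_sector_regular[OF c(1,2) refl] and 2 = narrow_sector_regular[OF c(3,4) refl]
  show "closed S" unfolding split using 1(1) 2(1) by (rule closed_Un)
  have int: "interior (?T a c) \<subseteq> interior S" "interior (?T c b) \<subseteq> interior S"
    unfolding split by (auto intro!: interior_mono)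
  show "S \<subseteq> closure (interior S)"
  proof -
    have "?T a c \<subseteq> closure (interior S)" using 1(2) closure_mono[OF int(1)] by (rule order_trans)
    moreover have "?T c b \<subseteq> closure (interior S)" using 2(2) closure_mono[OF int(2)] by (rule order_trans)
    ultimately show ?thesis unfolding split by (rule Un_least)
  qed
  have "0 = (vector [0 * cos a, 0 * sin a] :: real^2)" by (simp add: vec_eq_iff forall_2)
  then show "0 \<in> S" unfolding S using ab by fastforce
  show "t *\<^sub>R x \<in> S" if "t > 0" "x \<in> S" for t x
  proof -
    obtain r q where rq: "0 \<le> r" "q \<in> {a..b}" "x = vector [r * cos q, r * sin q]"
      using \<open>x \<in> S\<close> unfolding S by blast
    have "t *\<^sub>R x = vector [(t * r) * cos q, (t * r) * sin q]"
      unfolding rq(3) by (simp add: vec_eq_iff forall_2)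
    moreover have "0 \<le> t * r" using rq(1) that by simp
    ultimately show ?thesis unfolding S using rq(2) by blast
  qed
qed

section \<open>Signs of the minimizer and conclusion\<close>

text \<open>By continuity a violation would occur on a nonempty open set, which is not
  negligible.\<close>

lemma AE_nonneg_on_open_imp_nonneg:
  fixes u :: "'a::euclidean_space \<Rightarrow> real"
  assumes "open U" and cont: "continuous_on UNIV u" and ae: "AE x in lebesgue. x \<in> U \<longrightarrow> u x \<ge> 0"
    and x: "x \<in> U"
  shows "u x \<ge> 0"
proof (rule ccontr)
  assume neg: "\<not> ?thesis"
  let ?V = "U \<inter> {y. u y < 0}"
  have "open ?V" using \<open>open U\<close> cont by (intro open_Int open_Collect_less continuous_on_const)
  moreover have "?V \<noteq> {}" using x neg by auto
  moreover have "negligible ?V"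
  proof -
    obtain N where N: "N \<in> null_sets lebesgue" "{x \<in> space lebesgue. \<not> (x \<in> U \<longrightarrow> u x \<ge> 0)} \<subseteq> N"
      using ae unfolding eventually_ae_filter by blast
    have "negligible N" using N(1) by (simp add: negligible_iff_null_sets)
    then show ?thesis by (rule negligible_subset) (use N(2) in auto)
  qed
  ultimately show False using open_not_negligible by blast
qed

theorem theorem1p4:
  fixes s \<sigma> :: real and u :: "real^2 \<Rightarrow> real" and E :: "(real^2) set"
  assumes "0 < s" "s < 1" and "0 < \<sigma>" "\<sigma> < 1"
    and "\<And>\<Omega>. bounded_lipschitz_domain \<Omega> \<Longrightarrow> minimizing_pair s \<sigma> \<Omega> u E"
    and "continuous_on UNIV u"
    and "homogeneous (s - \<sigma> / 2) u"
    and "\<exists>\<S>. finite \<S> \<and> (\<forall>S\<in>\<S>. closed_sector S) \<and> E = \<Union>\<S>"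
    and "E \<noteq> {}" and "- E \<noteq> {}"
  shows "halfplane E"
proof -
  let ?B = "ball (0::real^2) 1"
  obtain \<S> where \<S>: "finite \<S>" "\<forall>S\<in>\<S>. closed_sector S" "E = \<Union>\<S>" using assms(8) by blast
  have closed: "closed E" unfolding \<S>(3) using \<S>(1,2) closed_sector_regular(1) by blast
  have cone: "t *\<^sub>R x \<in> E" if "t > 0" "x \<in> E" for t x
    using that \<S>(2) closed_sector_regular(4) unfolding \<S>(3) by blast
  have zero: "0 \<in> E" using assms(9) \<S>(2) closed_sector_regular(3) unfolding \<S>(3) by blast
  have reg: "E \<subseteq> closure (interior E)"
  proof
    fix x assume "x \<in> E"
    then obtain S where S: "S \<in> \<S>" "x \<in> S" unfolding \<S>(3) by blast
    have "closure (interior S) \<subseteq> closure (interior E)"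
      unfolding \<S>(3) using S by (intro closure_mono interior_mono) blast
    then show "x \<in> closure (interior E)" using S \<S>(2) closed_sector_regular(2) by blast
  qed
  have min: "minimizing_pair s \<sigma> ?B u E" by (rule assms(5)[OF bounded_lipschitz_domain_unit_ball])
  then obtain \<phi> E\<^sub>0 where adm: "admissible s ?B \<phi> E\<^sub>0 u E" unfolding minimizing_pair_def by blast
  then have "AE x in lebesgue. x \<in> E \<inter> ?B \<longrightarrow> u x \<ge> 0" "AE x in lebesgue. x \<in> - E \<inter> ?B \<longrightarrow> u x \<le> 0"
    unfolding admissible_def by blast+
  \<comment> \<open>Passing to the interior gives an open set on which the almost everywhere sign
    becomes a pointwise one; the rest of \<open>E\<close> is reached by closure.\<close>
  then have ae: "AE x in lebesgue. x \<in> interior E \<inter> ?B \<longrightarrow> u x \<ge> 0"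
      "AE x in lebesgue. x \<in> - E \<inter> ?B \<longrightarrow> - u x \<ge> 0"
    using interior_subset[of E] by (auto elim!: eventually_mono)
  \<comment> \<open>Every point is scaled into the ball, and homogeneity carries the sign found
    there back to the point.\<close>
  have scale: "0 < 1 / (norm x + 1)" "(1 / (norm x + 1)) *\<^sub>R x \<in> ?B" for x :: "real^2"
    using norm_ge_zero[of x] by (simp_all add: add_nonneg_pos divide_less_eq)
  have hom: "u (t *\<^sub>R x) = t powr (s - \<sigma> / 2) * u x" if "t > 0" for t x
    using assms(7) that by (simp add: homogeneous_def)
  have int_cone: "t *\<^sub>R x \<in> interior E" if "t > 0" "x \<in> interior E" for t x
  proof -
    have "(\<lambda>x. t *\<^sub>R x) ` interior E \<subseteq> E" using cone[OF that(1)] interior_subset by blast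
    moreover have "open ((\<lambda>x. t *\<^sub>R x) ` interior E)" using that(1) by (intro open_scaling) auto
    ultimately have "(\<lambda>x. t *\<^sub>R x) ` interior E \<subseteq> interior E" by (rule interior_maximal)
    then show ?thesis using that(2) by blast
  qed
  have pos_int: "u x \<ge> 0" if "x \<in> interior E" for x
  proof -
    have "u ((1 / (norm x + 1)) *\<^sub>R x) \<ge> 0"
      by (rule AE_nonneg_on_open_imp_nonneg[OF _ assms(6) ae(1)])
        (use scale int_cone that in auto)
    then show ?thesis
      unfolding hom[OF scale(1)] using scale(1)[of x] by (simp add: zero_le_mult_iff)
  qed
  have pos: "u x \<ge> 0" if "x \<in> E" for x
  proof -
    have "closed {x. u x \<ge> 0}" using assms(6) by (intro closed_Collect_le continuous_on_const)
    then have "closure (interior E) \<subseteq> {x. u x \<ge> 0}" using pos_int by (intro closure_minimal) auto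
    then show ?thesis using that reg by blast
  qed
  have neg: "u x \<le> 0" if "x \<notin> E" for x
  proof -
    have "(1 / (norm x + 1)) *\<^sub>R x \<notin> E"
      using cone[of "norm x + 1" "(1 / (norm x + 1)) *\<^sub>R x"] that scale(1)[of x] by auto
    then have "- u ((1 / (norm x + 1)) *\<^sub>R x) \<ge> 0"
      by (intro AE_nonneg_on_open_imp_nonneg[OF _ _ ae(2)])
        (use scale closed assms(6) in \<open>auto intro: continuous_on_minus\<close>)
    then show ?thesis
      unfolding hom[OF scale(1)] using scale(1)[of x] by (simp add: mult_le_0_iff)
  qed
  obtain m where m: "0 \<le> m" and
    bound: "\<And>t e A B. \<lbrakk>\<bar>t\<bar> * (4 * norm e) \<le> 1/16; A \<in> sets borel; B \<in> sets borel;
        A \<subseteq> E - inv (push t e) -` E; B \<subseteq> inv (push t e) -` E - E\<rbrakk>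
      \<Longrightarrow> pair_energy (2 + \<sigma>) ?B (\<lambda>x y. indicator A x * indicator B y)
        \<le> ennreal (400 * (t * (4 * norm e))\<^sup>2 * m)"
    using interaction_bound[OF assms(1-4) min assms(6) borel_closed[OF closed] pos neg] by metis
  show ?thesis
  proof (rule halfplane_of_translation_dichotomy[OF closed zero _ cone])
    show "E \<noteq> UNIV" using assms(10) by auto
    show "(\<forall>x\<in>E. x + e \<in> E) \<or> (\<forall>x\<in>E. x - e \<in> E)" for e
      by (rule cone_translation_dichotomy[OF closed reg cone assms(3,4) bound m])
  qed
qed

end
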